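(* Let $M$ and $N$ be unital complex Jordan-Banach algebras. Suppose that $\mathfrak{M}\subseteq M^{-1}$ and $\mathfrak{N}\subseteq N^{-1}$ are non-empty clopen quadratic subsets of $M^{-1}$ and $N^{-1}$, respectively, which are closed for powers and inverses. Let $\Delta : \mathfrak{M}\to \mathfrak{N}$ be a surjective isometry. Then for each $w_0$ in the McCrimmon radical of $N$ the mapping $a\mapsto \Delta (a) - w_0$ is a surjective isometry from $\mathfrak{M}$ to $\mathfrak{N}$. Furthermore, there exist a surjective real-linear isometry $T_0: M\to N$ and an element $u_0$ in the McCrimmon radical of $N$ such that $\Delta (a) = T_0(a) +u_0$ for all $a\in \mathfrak{M}$.
   Context: A complex Jordan algebra is a (not necessarily associative) complex algebra $M$ whose product $\circ$ is commutative and satisfies $(a\circ b)\circ a^2 = a\circ (b\circ a^2)$ for all $a,b$. A unital complex Jordan-Banach algebra is a complex Jordan algebra with unit $\mathbf{1}$ and a complete norm with $\|a\circ b\|\le \|a\|\,\|b\|$ and $\|\mathbf{1}\|=1$. Powers are defined by $a^0=\mathbf{1}$, $a^1=a$, $a^{n+1}=a\circ a^n$. For $a\in M$, $U_a(x) = 2(a\circ x)\circ a - a^2\circ x$ $(x\in M)$. An element $a\in M$ is invertible if there is $b\in M$ with $a\circ b=\mathbf{1}$ and $a^2\circ b=a$; such $b$ is unique and denoted $a^{-1}$. $M^{-1}$ denotes the set of invertible elements, with the norm topology; "clopen subset of $M^{-1}$" means relatively open and closed in $M^{-1}$. A subset $\mathfrak{M}\subseteq M^{-1}$ is called quadratic if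 $U_a(b)\in\mathfrak{M}$ for all $a,b\in\mathfrak{M}$. It is closed for powers and inverses if $a^n\in\mathfrak{M}$ ($n\in\mathbb{N}$) and $a^{-1}\in\mathfrak{M}$ whenever $a\in\mathfrak{M}$. An ideal of $M$ is a linear subspace $J$ with $U_M(J)\subseteq J$, $U_J(M)\subseteq J$ and $J^2\subseteq J$ (equivalently, in the unital case, $J\circ M\subseteq J$). An element $a$ is quasi-invertible if $\mathbf{1}-a$ is invertible; an ideal is quasi-invertible if all its elements are quasi-invertible in $M$. The McCrimmon radical $\mathcal{R}ad(M)$ is the unique largest quasi-invertible ideal of $M$ (it contains all quasi-invertible ideals). An isometry between subsets of normed spaces is a map $\Delta$ with $\|\Delta(a)-\Delta(b)\|=\|a-b\|$ for all $a,b$ in its domain (no linearity assumed). *)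

theory Defs
  imports "HOL-Analysis.Analysis"
begin

class scaleC = scaleR +
  fixes scaleC :: "complex \<Rightarrow> 'a \<Rightarrow> 'a"  (infixr \<open>*\<^sub>C\<close> 75)
  assumes scaleR_scaleC: "r *\<^sub>R x = complex_of_real r *\<^sub>C x"

class complex_banach = banach + scaleC +
  assumes scaleC_add_right: "c *\<^sub>C (x + y) = c *\<^sub>C x + c *\<^sub>C y"
    and scaleC_add_left: "(c + d) *\<^sub>C x = c *\<^sub>C x + d *\<^sub>C x"
    and scaleC_scaleC: "c *\<^sub>C (d *\<^sub>C x) = (c * d) *\<^sub>C x"
    and scaleC_one: "1 *\<^sub>C x = x"
    and norm_scaleC: "norm (c *\<^sub>C x) = cmod c * norm x"

text \<open>
  The Jordan product is commutative, so linearity in the first argument gives bilinearity.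
\<close>

class unital_complex_jordan_banach = complex_banach +
  fixes jprod :: "'a \<Rightarrow> 'a \<Rightarrow> 'a"  (infixl \<open>\<circ>\<^sub>J\<close> 70)
    and junit :: 'a  (\<open>\<one>\<^sub>J\<close>)
  assumes jprod_commute: "a \<circ>\<^sub>J b = b \<circ>\<^sub>J a"
    and jprod_add_left: "(a + b) \<circ>\<^sub>J c = a \<circ>\<^sub>J c + b \<circ>\<^sub>J c"
    and jprod_scaleC_left: "(z *\<^sub>C a) \<circ>\<^sub>J b = z *\<^sub>C (a \<circ>\<^sub>J b)"
    and jordan_identity: "(a \<circ>\<^sub>J b) \<circ>\<^sub>J (a \<circ>\<^sub>J a) = a \<circ>\<^sub>J (b \<circ>\<^sub>J (a \<circ>\<^sub>J a))"
    and junit_left: "\<one>\<^sub>J \<circ>\<^sub>J a = a"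
    and norm_jprod_le: "norm (a \<circ>\<^sub>J b) \<le> norm a * norm b"
    and norm_junit: "norm \<one>\<^sub>J = 1"

primrec jpow :: "'a::unital_complex_jordan_banach \<Rightarrow> nat \<Rightarrow> 'a" where
  "jpow a 0 = \<one>\<^sub>J"
| "jpow a (Suc n) = a \<circ>\<^sub>J jpow a n"

definition U_op :: "'a::unital_complex_jordan_banach \<Rightarrow> 'a \<Rightarrow> 'a" where
  "U_op a x = 2 *\<^sub>C ((a \<circ>\<^sub>J x) \<circ>\<^sub>J a) - jpow a 2 \<circ>\<^sub>J x"

definition is_jinverse :: "'a::unital_complex_jordan_banach \<Rightarrow> 'a \<Rightarrow> bool" where
  "is_jinverse a b \<longleftrightarrow> a \<circ>\<^sub>J b = \<one>\<^sub>J \<and> jpow a 2 \<circ>\<^sub>J b = a"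

definition jinvertible :: "'a::unital_complex_jordan_banach \<Rightarrow> bool" where
  "jinvertible a \<longleftrightarrow> (\<exists>b. is_jinverse a b)"

definition jinv :: "'a::unital_complex_jordan_banach \<Rightarrow> 'a" where
  "jinv a = (THE b. is_jinverse a b)"

definition jinvertibles :: "'a::unital_complex_jordan_banach set" where
  "jinvertibles = {a. jinvertible a}"

definition clopen_in_jinvertibles :: "'a::unital_complex_jordan_banach set \<Rightarrow> bool" where
  "clopen_in_jinvertibles S \<longleftrightarrow>
     openin (top_of_set jinvertibles) S \<and> closedin (top_of_set jinvertibles) S"

definition quadratic_set :: "'a::unital_complex_jordan_banach set \<Rightarrow> bool" where
  "quadratic_set S \<longleftrightarrow> (\<forall>a\<in>S. \<forall>b\<in>S. U_op a b \<in> S)"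

text \<open>
  Only exponents \<open>n \<ge> 1\<close> are required. For a non-empty quadratic set of invertible elements
  this already yields the unit, since \<open>U\<^sub>a((a\<^sup>2)\<^sup>-\<^sup>1) = \<one>\<close>.
\<close>

definition closed_powers_inverses :: "'a::unital_complex_jordan_banach set \<Rightarrow> bool" where
  "closed_powers_inverses S \<longleftrightarrow> (\<forall>a\<in>S. (\<forall>n\<ge>1. jpow a n \<in> S) \<and> jinv a \<in> S)"

definition csubspace :: "'a::complex_banach set \<Rightarrow> bool" where
  "csubspace J \<longleftrightarrow>
     0 \<in> J \<and> (\<forall>x\<in>J. \<forall>y\<in>J. x + y \<in> J) \<and> (\<forall>c. \<forall>x\<in>J. c *\<^sub>C x \<in> J)"

definition jideal :: "'a::unital_complex_jordan_banach set \<Rightarrow> bool" where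
  "jideal J \<longleftrightarrow> csubspace J \<and>
     (\<forall>a. \<forall>x\<in>J. U_op a x \<in> J) \<and>
     (\<forall>x\<in>J. \<forall>a. U_op x a \<in> J) \<and>
     (\<forall>x\<in>J. \<forall>y\<in>J. x \<circ>\<^sub>J y \<in> J)"

definition quasi_invertible :: "'a::unital_complex_jordan_banach \<Rightarrow> bool" where
  "quasi_invertible a \<longleftrightarrow> jinvertible (\<one>\<^sub>J - a)"

definition quasi_invertible_ideal :: "'a::unital_complex_jordan_banach set \<Rightarrow> bool" where
  "quasi_invertible_ideal J \<longleftrightarrow> jideal J \<and> (\<forall>a\<in>J. quasi_invertible a)"

text \<open>Sets are ordered by inclusion, so this is the quasi-invertible ideal containing all others.\<close>

definition mccrimmon_radical :: "'a::unital_complex_jordan_banach set" where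
  "mccrimmon_radical = (GREATEST J. quasi_invertible_ideal J)"

definition surjective_isometry ::
    "('a::real_normed_vector \<Rightarrow> 'b::real_normed_vector) \<Rightarrow> 'a set \<Rightarrow> 'b set \<Rightarrow> bool" where
  "surjective_isometry f A B \<longleftrightarrow>
     f ` A = B \<and> (\<forall>a\<in>A. \<forall>b\<in>A. norm (f a - f b) = norm (a - b))"

end

(*
  The fundamental formula U_{U_a b} = U_a U_b U_a shows that a is invertible as soon as U_a b is
  invertible for some b. Hence a - w is invertible for a invertible and w in a quasi-invertible
  ideal, so sums of quasi-invertible ideals are quasi-invertible and the radical is the union of
  all of them; moreover the segment from a to a - w consists of invertible elements, so clopen sets
  are stable under translation by radical elements.

  By a local Mazur-Ulam argument, Delta agrees with an affine map T + u on the open connected set W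
  of all c(1 + x) with c nonzero complex and |x| < 1/4, which lies in the clopen set. For an
  arbitrary a, write Delta a = T y + u. Then |w - y| = |w - a| for all w in W, which gives
  |1 + c (a - y)| = 1 for all small complex c and hence a = y. Finally, Delta = T + u and the
  stability of the clopen sets under nonzero scalars imply that N + c u is contained in N for all
  complex c, and the vectors u with this property form a quasi-invertible ideal.
*)
theory Submission
  imports Defs
begin

section \<open>The fundamental formula\<close>

lemma jprod_add_right: "a \<circ>\<^sub>J (b + c) = a \<circ>\<^sub>J b + a \<circ>\<^sub>J (c::'a::unital_complex_jordan_banach)"
  by (metis jprod_add_left jprod_commute)

lemma jprod_scaleC_right: "a \<circ>\<^sub>J (z *\<^sub>C b) = z *\<^sub>C (a \<circ>\<^sub>J (b::'a::unital_complex_jordan_banach))"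
  by (metis jprod_scaleC_left jprod_commute)

lemma jprod_scaleR_left: "(r *\<^sub>R a) \<circ>\<^sub>J b = r *\<^sub>R (a \<circ>\<^sub>J (b::'a::unital_complex_jordan_banach))"
  by (simp add: scaleR_scaleC jprod_scaleC_left)

lemma jprod_scaleR_right: "a \<circ>\<^sub>J (r *\<^sub>R b) = r *\<^sub>R (a \<circ>\<^sub>J (b::'a::unital_complex_jordan_banach))"
  by (simp add: scaleR_scaleC jprod_scaleC_right)

lemma bounded_bilinear_jprod:
  "bounded_bilinear ((\<circ>\<^sub>J) :: 'a::unital_complex_jordan_banach \<Rightarrow> 'a \<Rightarrow> 'a)"
  by standard
    (auto simp: jprod_add_left jprod_add_right jprod_scaleR_left jprod_scaleR_right
      intro!: exI[of _ 1] norm_jprod_le)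

interpretation jprod: bounded_bilinear "(\<circ>\<^sub>J) :: 'a::unital_complex_jordan_banach \<Rightarrow> 'a \<Rightarrow> 'a"
  by (rule bounded_bilinear_jprod)

lemmas jprod_linear_simps =
  jprod.add_left jprod.add_right jprod.diff_left jprod.diff_right jprod.minus_left jprod.minus_right
  jprod_scaleR_left jprod_scaleR_right

lemma junit_right [simp]: "a \<circ>\<^sub>J \<one>\<^sub>J = (a::'a::unital_complex_jordan_banach)"
  by (metis junit_left jprod_commute)

declare junit_left [simp]

text \<open>The Jordan identity is cubic in its first variable; this is its full polarisation, with
  \<open>w\<close> in the linear slot.\<close>

lemma jordan_linearized:
  fixes x y z w :: "'a::unital_complex_jordan_banach"
  shows "(x \<circ>\<^sub>J y) \<circ>\<^sub>J (z \<circ>\<^sub>J w) + (y \<circ>\<^sub>J z) \<circ>\<^sub>J (x \<circ>\<^sub>J w) + (z \<circ>\<^sub>J x) \<circ>\<^sub>J (y \<circ>\<^sub>J w) =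
    z \<circ>\<^sub>J ((x \<circ>\<^sub>J y) \<circ>\<^sub>J w) + x \<circ>\<^sub>J ((y \<circ>\<^sub>J z) \<circ>\<^sub>J w) + y \<circ>\<^sub>J ((z \<circ>\<^sub>J x) \<circ>\<^sub>J w)"
proof -
  define J where "J a = (a \<circ>\<^sub>J w) \<circ>\<^sub>J (a \<circ>\<^sub>J a) - a \<circ>\<^sub>J (w \<circ>\<^sub>J (a \<circ>\<^sub>J a))" for a
  have J0: "J a = 0" for a by (simp add: J_def jordan_identity)
  define F where "F = (x \<circ>\<^sub>J y) \<circ>\<^sub>J (z \<circ>\<^sub>J w) + (y \<circ>\<^sub>J z) \<circ>\<^sub>J (x \<circ>\<^sub>J w) + (z \<circ>\<^sub>J x) \<circ>\<^sub>J (y \<circ>\<^sub>J w) -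
    (z \<circ>\<^sub>J ((x \<circ>\<^sub>J y) \<circ>\<^sub>J w) + x \<circ>\<^sub>J ((y \<circ>\<^sub>J z) \<circ>\<^sub>J w) + y \<circ>\<^sub>J ((z \<circ>\<^sub>J x) \<circ>\<^sub>J w))"
  \<comment> \<open>The alternating sum over the non-empty subsets of x, y, z keeps only the part of
    \<open>J\<close> that is linear in each of them, in which every product occurs twice.\<close>
  have "J (x + y + z) - J (x + y) - J (y + z) - J (x + z) + J x + J y + J z = F + F"
    unfolding J_def F_def by (simp add: jprod_linear_simps jprod_commute algebra_simps)
  hence "F + F = 0" by (simp add: J0)
  hence "2 *\<^sub>R F = 0" by (simp add: scaleR_2)
  thus ?thesis by (simp add: F_def)
qed

text \<open>The left side of \<open>jordan_linearized\<close> is symmetric in \<open>z\<close> and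
  \<open>w\<close>, so two right sides agree. Solved for one term, this writes multiplication by
  \<open>(x \<circ>\<^sub>J y) \<circ>\<^sub>J z\<close> through multiplications by the factors and
  their pairwise products.\<close>

lemma jprod_jprod_left:
  fixes x y z w :: "'a::unital_complex_jordan_banach"
  shows "((x \<circ>\<^sub>J y) \<circ>\<^sub>J z) \<circ>\<^sub>J w =
    z \<circ>\<^sub>J ((x \<circ>\<^sub>J y) \<circ>\<^sub>J w) + x \<circ>\<^sub>J ((y \<circ>\<^sub>J z) \<circ>\<^sub>J w) + y \<circ>\<^sub>J ((z \<circ>\<^sub>J x) \<circ>\<^sub>J w)
    - x \<circ>\<^sub>J (z \<circ>\<^sub>J (y \<circ>\<^sub>J w)) - y \<circ>\<^sub>J (z \<circ>\<^sub>J (x \<circ>\<^sub>J w))"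
  using jordan_linearized[of x y z w] jordan_linearized[of x y w z]
  by (simp add: jprod_commute algebra_simps)

lemma jprod_square_commute:
  "(a \<circ>\<^sub>J a) \<circ>\<^sub>J (a \<circ>\<^sub>J x) = a \<circ>\<^sub>J ((a \<circ>\<^sub>J a) \<circ>\<^sub>J (x::'a::unital_complex_jordan_banach))"
  by (metis jordan_identity jprod_commute)

text \<open>The Jordan triple product {x, z, y}: \<open>U_op\<close> polarised in its outer
  variables, with the middle variable as second argument.\<close>

definition jtriple :: "'a::unital_complex_jordan_banach \<Rightarrow> 'a \<Rightarrow> 'a \<Rightarrow> 'a" where
  "jtriple x z y = x \<circ>\<^sub>J (y \<circ>\<^sub>J z) + y \<circ>\<^sub>J (x \<circ>\<^sub>J z) - (x \<circ>\<^sub>J y) \<circ>\<^sub>J z"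

lemma jtriple_commute: "jtriple x z y = jtriple y z x"
  by (simp add: jtriple_def jprod_commute algebra_simps)

lemma jtriple_linear:
  "jtriple (x + x') z y = jtriple x z y + jtriple x' z y"
  "jtriple x (z + z') y = jtriple x z y + jtriple x z' y"
  "jtriple x z (y + y') = jtriple x z y + jtriple x z y'"
  "jtriple (x - x') z y = jtriple x z y - jtriple x' z y"
  "jtriple x (z - z') y = jtriple x z y - jtriple x z' y"
  "jtriple x z (y - y') = jtriple x z y - jtriple x z y'"
  "jtriple (r *\<^sub>R x) z y = r *\<^sub>R jtriple x z y"
  "jtriple x (r *\<^sub>R z) y = r *\<^sub>R jtriple x z y"
  "jtriple x z (r *\<^sub>R y) = r *\<^sub>R jtriple x z y"
  by (simp_all add: jtriple_def jprod_linear_simps algebra_simps)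

text \<open>Follows from \<open>jprod_jprod_left\<close> symmetrised in \<open>x\<close> and
  \<open>y\<close>. Later \<open>a\<close> is replaced by its powers, so that a multiplication in
  one outer slot can be traded for one in the other.\<close>

lemma jtriple_derivation:
  "jtriple (a \<circ>\<^sub>J x) z y + jtriple x z (a \<circ>\<^sub>J y) = a \<circ>\<^sub>J jtriple x z y + jtriple x (a \<circ>\<^sub>J z) y"
  using arg_cong2[where f = "(+)", OF jprod_jprod_left[of a x y z] jprod_jprod_left[of a y x z]]
    jordan_linearized[of x y a z]
  by (simp add: jtriple_def jprod_linear_simps jprod_commute algebra_simps)

lemma U_op_eq_jtriple: "U_op a x = jtriple a x a"
  by (simp add: U_op_def jtriple_def numeral_2_eq_2 jprod_commute jprod.add_left
    scaleR_scaleC[of 2, simplified, symmetric] scaleR_2)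

lemma jprod_power3:
  "(a \<circ>\<^sub>J (a \<circ>\<^sub>J a)) \<circ>\<^sub>J x = 3 *\<^sub>R (a \<circ>\<^sub>J ((a \<circ>\<^sub>J a) \<circ>\<^sub>J x)) - 2 *\<^sub>R (a \<circ>\<^sub>J (a \<circ>\<^sub>J (a \<circ>\<^sub>J x)))"
proof -
  have "(a \<circ>\<^sub>J a) \<circ>\<^sub>J a = a \<circ>\<^sub>J (a \<circ>\<^sub>J a)" by (rule jprod_commute)
  thus ?thesis
    using jprod_jprod_left[of a a a x] by (simp add: scaleR_2 scaleR_left.add[of 2 1, simplified])
qed

lemma jprod_U_op: "a \<circ>\<^sub>J U_op a x = U_op a (a \<circ>\<^sub>J x)"
  by (simp add: U_op_eq_jtriple jtriple_def jprod_linear_simps jprod_square_commute)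

lemma jprod_square_U_op: "(a \<circ>\<^sub>J a) \<circ>\<^sub>J U_op a x = U_op a ((a \<circ>\<^sub>J a) \<circ>\<^sub>J x)"
  by (simp add: U_op_eq_jtriple jtriple_def jprod_linear_simps jprod_square_commute)

text \<open>The case of the fundamental formula in which the inner element is the unit. It comes
  first because it expresses multiplication by the fourth power of \<open>a\<close> through
  multiplications by \<open>a\<close> and its square.\<close>

lemma U_op_square: "U_op (a \<circ>\<^sub>J a) x = U_op a (U_op a x)"
proof -
  let ?a2 = "a \<circ>\<^sub>J a"
  let ?t = jtriple
  have 1: "?t ?a2 z a = a \<circ>\<^sub>J U_op a z" for z
    using jtriple_derivation[of a a z a] jtriple_commute[of ?a2 z a]
    by (simp add: jprod_U_op flip: U_op_eq_jtriple scaleR_2)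
  have 2: "?t (a \<circ>\<^sub>J ?a2) z a = ?a2 \<circ>\<^sub>J U_op a z" for z
    using jtriple_derivation[of ?a2 a z a] jtriple_commute[of "?a2 \<circ>\<^sub>J a" z a]
    by (simp add: jprod_square_U_op jprod_commute[of ?a2 a] flip: U_op_eq_jtriple scaleR_2)
  have "?t (a \<circ>\<^sub>J ?a2) x a + U_op ?a2 x = a \<circ>\<^sub>J ?t ?a2 x a + ?t ?a2 (a \<circ>\<^sub>J x) a"
    using jtriple_derivation[of a ?a2 x a] by (simp add: U_op_eq_jtriple)
  hence "U_op ?a2 x = 2 *\<^sub>R (a \<circ>\<^sub>J (a \<circ>\<^sub>J U_op a x)) - ?a2 \<circ>\<^sub>J U_op a x"
    unfolding 1 2 by (simp add: jprod_U_op scaleR_2 algebra_simps)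
  thus ?thesis
    by (simp add: U_op_eq_jtriple[of a "U_op a x"] jtriple_def scaleR_2)
qed

lemma U_op_eq: "U_op a x = 2 *\<^sub>R (a \<circ>\<^sub>J (a \<circ>\<^sub>J x)) - (a \<circ>\<^sub>J a) \<circ>\<^sub>J x"
  by (simp add: U_op_eq_jtriple jtriple_def scaleR_2)

text \<open>The derivation identity for \<open>a\<close>, \<open>a\<^sup>2\<close>, \<open>a\<^sup>3\<close>, \<open>a\<^sup>4\<close> says that
  \<open>p \<otimes> q \<mapsto> {px, z, qx}\<close> intertwines the power sums \<open>M\<^sub>k \<otimes> 1 + 1 \<otimes> M\<^sub>k\<close>, where \<open>M\<^sub>k\<close> is
  multiplication by \<open>a\<^sup>k\<close>, with \<open>X \<mapsto> M\<^sub>k X + X M\<^sub>k\<close> for \<open>X = U\<^sub>x\<close>. By Newton's identities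
  \<open>U\<^sub>a \<otimes> U\<^sub>a\<close> is a polynomial in the power sums, since it corresponds to the fourth elementary
  symmetric function. Below, the operators acting on the last argument of the triple product are
  moved to the first one until the two sides agree.\<close>

theorem U_op_fundamental:
  fixes a x z :: "'a::unital_complex_jordan_banach"
  shows "U_op (U_op a x) z = U_op a (U_op x (U_op a z))"
proof -
  define L where "L y = a \<circ>\<^sub>J y" for y
  define K where "K y = (a \<circ>\<^sub>J a) \<circ>\<^sub>J y" for y
  define t :: "'a \<Rightarrow> 'a \<Rightarrow> 'a \<Rightarrow> 'a" where "t = jtriple"
  define U where "U y = 2 *\<^sub>R L (L y) - K y" for y
  have L: "L (u + v) = L u + L v" "L (u - v) = L u - L v" "L (r *\<^sub>R u) = r *\<^sub>R L u" for u v r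
    by (simp_all add: L_def jprod_linear_simps)
  have K: "K (u + v) = K u + K v" "K (u - v) = K u - K v" "K (r *\<^sub>R u) = r *\<^sub>R K u" for u v r
    by (simp_all add: K_def jprod_linear_simps)
  have KL: "K (L u) = L (K u)" for u by (simp add: K_def L_def jprod_square_commute)
  note lin = L K KL jtriple_linear[where 'a='a, folded t_def]
  have tc: "t p u q = t q u p" for p q u by (simp add: t_def jtriple_commute)
  define T where "T F z = L (F z) + F (L z)" for F z
  define S where "S F z = K (F z) + F (K z)" for F z
  have tL: "t p z (L q) = T (\<lambda>z. t p z q) z - t (L p) z q" for p q z
    using jtriple_derivation[of a p z q] by (simp add: t_def L_def T_def algebra_simps)
  have tK: "t p z (K q) = S (\<lambda>z. t p z q) z - t (K p) z q" for p q z
    using jtriple_derivation[of "a \<circ>\<^sub>J a" p z q] by (simp add: t_def K_def S_def algebra_simps)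
  define X where "X z = t x z x" for z
  have X: "X (u + v) = X u + X v" "X (u - v) = X u - X v" "X (r *\<^sub>R u) = r *\<^sub>R X u" for u v r
    by (simp_all add: X_def lin)
  have half: "u = (1/2) *\<^sub>R v" if "u = v - u" for u v :: 'a
  proof -
    have "2 *\<^sub>R u = v" using that by (simp add: scaleR_2 algebra_simps)
    thus ?thesis by auto
  qed
  have 1: "t (L x) z x = (1/2) *\<^sub>R T X z" for z
  proof (rule half)
    show "t (L x) z x = T X z - t (L x) z x"
      using tL[of x z x] jtriple_commute[of x z "L x"] by (simp add: t_def X_def T_def)
  qed
  have 2: "t (K x) z x = (1/2) *\<^sub>R S X z" for z
  proof (rule half)
    show "t (K x) z x = S X z - t (K x) z x"
      using tK[of x z x] jtriple_commute[of x z "K x"] by (simp add: t_def X_def S_def)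
  qed
  define M3 where "M3 u = 3 *\<^sub>R L (K u) - 2 *\<^sub>R L (L (L u))" for u
  define M4 where "M4 u = K (K u) + 4 *\<^sub>R L (L (K u)) - 4 *\<^sub>R L (L (L (L u)))" for u
  have U: "U_op a u = U u" for u
    by (simp add: U_op_eq U_def L_def K_def)
  have M3: "M3 u = (a \<circ>\<^sub>J (a \<circ>\<^sub>J a)) \<circ>\<^sub>J u" for u
    by (simp add: jprod_power3 M3_def L_def K_def)
  have M4: "M4 u = ((a \<circ>\<^sub>J a) \<circ>\<^sub>J (a \<circ>\<^sub>J a)) \<circ>\<^sub>J u" for u
  proof -
    have "U (U u) = 2 *\<^sub>R K (K u) - ((a \<circ>\<^sub>J a) \<circ>\<^sub>J (a \<circ>\<^sub>J a)) \<circ>\<^sub>J u"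
      using U_op_square[of a u] by (simp add: U U_op_eq[of "a \<circ>\<^sub>J a"] K_def)
    hence "((a \<circ>\<^sub>J a) \<circ>\<^sub>J (a \<circ>\<^sub>J a)) \<circ>\<^sub>J u = 2 *\<^sub>R K (K u) - U (U u)" by simp
    \<comment> \<open>Linear identities between vectors are restated as a vanishing distance, which
      the \<open>norm\<close> method can decide.\<close>
    moreover have "dist (M4 u) (2 *\<^sub>R K (K u) - U (U u)) \<le> 0" unfolding U_def M4_def lin by norm
    ultimately show ?thesis by simp
  qed
  have tM3: "t (M3 x) z x = (1/2) *\<^sub>R (M3 (X z) + X (M3 z))" for z
  proof (rule half)
    show "t (M3 x) z x = M3 (X z) + X (M3 z) - t (M3 x) z x"
      using jtriple_derivation[of "a \<circ>\<^sub>J (a \<circ>\<^sub>J a)" x z x] tc[of x z "M3 x"]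
      by (simp add: t_def X_def M3 algebra_simps)
  qed
  have tM4: "t (M4 x) z x = (1/2) *\<^sub>R (M4 (X z) + X (M4 z))" for z
  proof (rule half)
    show "t (M4 x) z x = M4 (X z) + X (M4 z) - t (M4 x) z x"
      using jtriple_derivation[of "(a \<circ>\<^sub>J a) \<circ>\<^sub>J (a \<circ>\<^sub>J a)" x z x] tc[of x z "M4 x"]
      by (simp add: t_def X_def M4 algebra_simps)
  qed
  \<comment> \<open>Moving an odd number of operators across the triple product ends with a minus
    sign, so commutativity of the outer slots determines the term.\<close>
  have 3: "t (L (L (L x))) z x = (1/2) *\<^sub>R (3 *\<^sub>R T (\<lambda>z. t (L (L x)) z x) z
      - (1/2) *\<^sub>R T (T (T X)) z)" for z
  proof (rule half)
    have "t x z (L (L (L x))) = 3 *\<^sub>R T (\<lambda>z. t (L (L x)) z x) z - (1/2) *\<^sub>R T (T (T X)) z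
      - t (L (L (L x))) z x"
      unfolding dist_le_zero_iff[symmetric] tL 1 T_def lin X X_def[symmetric] by norm
    thus "t (L (L (L x))) z x = 3 *\<^sub>R T (\<lambda>z. t (L (L x)) z x) z - (1/2) *\<^sub>R T (T (T X)) z
      - t (L (L (L x))) z x"
      by (simp only: tc[of "L (L (L x))" z x])
  qed
  note ev = tL tK 1 2 3 T_def S_def lin X X_def[symmetric]
  \<comment> \<open>Solves \<open>tM3\<close> for the mixed term; \<open>3\<close> supplies the
    cubic one.\<close>
  have 4: "t (L (K x)) z x = (1/3) *\<^sub>R ((1/2) *\<^sub>R (M3 (X z) + X (M3 z)) + 2 *\<^sub>R t (L (L (L x))) z x)" for z
    unfolding tM3[symmetric] dist_le_zero_iff[symmetric] unfolding M3_def lin by norm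
  have 5: "t (L (L (K x))) z x = (1/2) *\<^sub>R (S (\<lambda>z. t (L (L x)) z x) z + 2 *\<^sub>R T (\<lambda>z. t (L (K x)) z x) z
      - (1/2) *\<^sub>R T (T (S X)) z)" for z
  proof (rule half)
    have "t x z (K (L (L x))) = S (\<lambda>z. t (L (L x)) z x) z + 2 *\<^sub>R T (\<lambda>z. t (L (K x)) z x) z
      - (1/2) *\<^sub>R T (T (S X)) z - t (L (L (K x))) z x"
      unfolding dist_le_zero_iff[symmetric] tK ev by norm
    thus "t (L (L (K x))) z x = S (\<lambda>z. t (L (L x)) z x) z + 2 *\<^sub>R T (\<lambda>z. t (L (K x)) z x) z
      - (1/2) *\<^sub>R T (T (S X)) z - t (L (L (K x))) z x"
      by (simp only: tc[of "L (L (K x))" z x] KL)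
  qed
  have 6: "t (K (K x)) z x = (1/2) *\<^sub>R (M4 (X z) + X (M4 z)) - 4 *\<^sub>R t (L (L (K x))) z x
      + 4 *\<^sub>R t (L (L (L (L x)))) z x" for z
    unfolding tM4[symmetric] dist_le_zero_iff[symmetric] unfolding M4_def lin by norm
  have "t (U x) z (U x) = U (X (U z))"
    unfolding dist_le_zero_iff[symmetric] U_def lin
    \<comment> \<open>The formulas above do not determine the terms in \<open>L (L x)\<close> and
      \<open>L (L (L (L x)))\<close>; these cancel.\<close>
    unfolding 6 5 4 M4_def M3_def ev by norm
  thus ?thesis by (simp add: U X_def) (simp add: U_op_eq_jtriple t_def)
qed

section \<open>Invertible elements and the radical\<close>

lemma jpow_2: "jpow a 2 = a \<circ>\<^sub>J (a :: 'a::unital_complex_jordan_banach)"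
  by (simp add: numeral_2_eq_2)

lemma U_op_linear_simps:
  "U_op a (x + y) = U_op a x + U_op a y"
  "U_op a (x - y) = U_op a x - U_op a y"
  "U_op a (r *\<^sub>R x) = r *\<^sub>R U_op a x"
  by (simp_all add: U_op_eq_jtriple jtriple_linear)

lemma scaleC_diff_right: "c *\<^sub>C (x - y) = c *\<^sub>C x - c *\<^sub>C (y::'a::complex_banach)"
  by (metis add_diff_cancel diff_add_cancel scaleC_add_right)

lemma U_op_scaleC: "U_op a (c *\<^sub>C x) = c *\<^sub>C U_op a x"
  by (simp add: U_op_eq scaleR_scaleC jprod_scaleC_right scaleC_diff_right scaleC_scaleC mult.commute)

lemma linear_U_op: "linear (U_op a)"
  by (rule linearI) (simp_all add: U_op_linear_simps)

lemma U_op_junit [simp]: "U_op \<one>\<^sub>J x = x"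
  by (simp add: U_op_eq scaleR_2)

lemma U_op_junit_right: "U_op a \<one>\<^sub>J = a \<circ>\<^sub>J a"
  by (simp add: U_op_eq scaleR_2)

text \<open>Through the fundamental formula the first value gives U_a U_b U_a = U_a, and the second
  gives U_a U_{b^2} U_a = id.\<close>

lemma is_jinverseD:
  assumes "is_jinverse a b"
  shows "U_op a b = a" "U_op a (b \<circ>\<^sub>J b) = \<one>\<^sub>J"
proof -
  have ab: "a \<circ>\<^sub>J b = \<one>\<^sub>J" "(a \<circ>\<^sub>J a) \<circ>\<^sub>J b = a"
    using assms by (auto simp: is_jinverse_def jpow_2)
  show "U_op a b = a" by (simp add: U_op_eq ab scaleR_2)
  have 1: "(a \<circ>\<^sub>J a) \<circ>\<^sub>J (b \<circ>\<^sub>J b) = \<one>\<^sub>J"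
    using jordan_linearized[of a a b b] by (simp add: ab jprod_commute[of b a])
  have 2: "a \<circ>\<^sub>J (a \<circ>\<^sub>J (b \<circ>\<^sub>J b)) = \<one>\<^sub>J"
    using jordan_linearized[of b b a a] 1
    by (simp add: ab jprod_commute[of b a] jprod_commute[of b "a \<circ>\<^sub>J a"] jprod_commute[of "b \<circ>\<^sub>J b"])
  show "U_op a (b \<circ>\<^sub>J b) = \<one>\<^sub>J" by (simp add: U_op_eq 1 2 scaleR_2)
qed

lemma bij_U_op:
  assumes "jinvertible a"
  shows "bij (U_op a)"
proof -
  obtain b where b: "is_jinverse a b" using assms by (auto simp: jinvertible_def)
  have "U_op a (U_op (b \<circ>\<^sub>J b) (U_op a z)) = z" for z
    using U_op_fundamental[of a "b \<circ>\<^sub>J b" z] by (simp add: is_jinverseD[OF b])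
  hence "U_op a \<circ> (U_op (b \<circ>\<^sub>J b) \<circ> U_op a) = id" "(U_op a \<circ> U_op (b \<circ>\<^sub>J b)) \<circ> U_op a = id"
    by (auto simp: fun_eq_iff)
  thus ?thesis
    by (metis bij_def comp_id fun.map_id inj_on_id inj_on_imageI2 surj_def comp_apply id_apply inj_def)
qed

lemma is_jinverse_unique:
  assumes "is_jinverse a b" "is_jinverse a c"
  shows "b = c"
  using bij_U_op[of a] assms is_jinverseD(1)[OF assms(1)] is_jinverseD(1)[OF assms(2)]
  by (metis bij_is_inj injD jinvertible_def)

lemma is_jinverse_jinv: "jinvertible a \<Longrightarrow> is_jinverse a (jinv a)"
  unfolding jinv_def jinvertible_def by (metis is_jinverse_unique theI)

lemma U_op_jinv:
  assumes "jinvertible a"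
  shows "U_op a (U_op (jinv a) x) = x" "U_op (jinv a) (U_op a x) = x"
proof -
  have 1: "U_op a (U_op (jinv a) (U_op a z)) = U_op a z" for z
    using U_op_fundamental[of a "jinv a" z] is_jinverseD(1)[OF is_jinverse_jinv[OF assms]] by simp
  show "U_op a (U_op (jinv a) x) = x" using 1 bij_U_op[OF assms] by (metis bij_pointE)
  show "U_op (jinv a) (U_op a x) = x" using 1 bij_U_op[OF assms] by (metis bij_pointE)
qed

text \<open>The inverse is the preimage of \<open>a\<close> under U_a. Multiplications by
  \<open>a\<close> and its square commute with U_a, so both defining equations may be checked after
  applying this injective map.\<close>

lemma jinvertible_if_bij_U_op:
  assumes "bij (U_op a)"
  shows "jinvertible a"
proof -
  obtain b where b: "U_op a b = a" using assms by (metis bij_pointE)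
  have "U_op a (a \<circ>\<^sub>J b) = U_op a \<one>\<^sub>J"
    by (simp add: b U_op_junit_right flip: jprod_U_op)
  moreover have "U_op a ((a \<circ>\<^sub>J a) \<circ>\<^sub>J b) = U_op a a"
    using jprod_square_U_op[of a b] by (simp add: b) (simp add: U_op_eq scaleR_2 jprod_commute)
  ultimately show ?thesis
    using assms by (auto simp: jinvertible_def is_jinverse_def jpow_2 bij_def inj_def)
qed

lemma jinvertible_iff_bij: "jinvertible a \<longleftrightarrow> bij (U_op a)"
  using bij_U_op jinvertible_if_bij_U_op by blast

text \<open>By the fundamental formula U_x is both the first and the last factor of a bijection,
  hence injective and surjective.\<close>

lemma jinvertible_if_U_op:
  assumes "jinvertible (U_op x y)"
  shows "jinvertible x"
proof -
  have "bij (U_op (U_op x y))" using assms by (simp add: jinvertible_iff_bij)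
  moreover have "U_op (U_op x y) = U_op x \<circ> (U_op y \<circ> U_op x)"
    by (auto simp: U_op_fundamental)
  ultimately have b: "bij (U_op x \<circ> (U_op y \<circ> U_op x))" by simp
  have "inj (U_op x)" using bij_is_inj[OF b] by (auto simp: inj_def)
  moreover have "surj (U_op x)"
    using bij_is_surj[OF b] unfolding surj_def comp_apply by blast
  ultimately show ?thesis by (simp add: jinvertible_iff_bij bij_def)
qed

lemma jinvertible_scaleC:
  assumes "jinvertible a" "c \<noteq> 0"
  shows "jinvertible (c *\<^sub>C a)"
proof -
  obtain b where "is_jinverse a b" using assms by (auto simp: jinvertible_def)
  hence "is_jinverse (c *\<^sub>C a) ((1/c) *\<^sub>C b)"
    using assms(2)
    by (simp add: is_jinverse_def jpow_2 jprod_scaleC_left jprod_scaleC_right scaleC_scaleC scaleC_one)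
  thus ?thesis by (auto simp: jinvertible_def)
qed

section \<open>Openness of the set of invertible elements\<close>

lemma norm_U_op_le: "norm (U_op a x) \<le> 3 * (norm a)\<^sup>2 * norm x"
proof -
  have "norm (a \<circ>\<^sub>J (a \<circ>\<^sub>J x)) \<le> norm a * (norm a * norm x)"
    by (meson mult_left_mono norm_ge_zero norm_jprod_le order_trans)
  moreover have "norm ((a \<circ>\<^sub>J a) \<circ>\<^sub>J x) \<le> (norm a * norm a) * norm x"
    by (meson mult_right_mono norm_ge_zero norm_jprod_le order_trans)
  moreover have "norm (U_op a x) \<le> 2 * norm (a \<circ>\<^sub>J (a \<circ>\<^sub>J x)) + norm ((a \<circ>\<^sub>J a) \<circ>\<^sub>J x)"
    unfolding U_op_eq by norm
  ultimately show ?thesis by (simp add: power2_eq_square)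
qed

text \<open>Solutions of \<open>f x = y\<close> are the fixed points of
  \<open>x \<mapsto> y - (f x - x)\<close>, which is a contraction.\<close>

lemma bij_if_near_id:
  fixes f :: "'a::banach \<Rightarrow> 'a"
  assumes f: "linear f" and c: "c < 1" and near: "\<And>x. norm (f x - x) \<le> c * norm x"
  shows "bij f"
proof -
  have "\<exists>!x. f x = y" for y
  proof -
    define d where "d = max c 0"
    have d: "0 \<le> d" "d < 1" using c by (auto simp: d_def)
    have "\<exists>!x. y - (f x - x) = x"
    proof (rule banach_fix_type[OF d], intro allI)
      fix u v :: 'a
      have "norm (f (v - u) - (v - u)) \<le> d * norm (v - u)"
        using order_trans[OF near mult_right_mono[of c d]] by (simp add: d_def)
      moreover have "(y - (f u - u)) - (y - (f v - v)) = f (v - u) - (v - u)"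
        by (simp add: linear_diff[OF f])
      ultimately show "dist (y - (f u - u)) (y - (f v - v)) \<le> d * dist u v"
        by (metis dist_norm norm_minus_commute)
    qed
    moreover have "y - (f x - x) = x \<longleftrightarrow> f x = y" for x by (auto simp: algebra_simps)
    ultimately show ?thesis by simp
  qed
  thus ?thesis by (simp add: bij_iff)
qed

lemma U_op_junit_plus: "U_op (\<one>\<^sub>J + x) y = y + 2 *\<^sub>R (x \<circ>\<^sub>J y) + U_op x y"
  by (simp add: U_op_eq jprod_linear_simps algebra_simps scaleR_2)

lemma jinvertible_junit_plus:
  assumes "norm x < 1/4"
  shows "jinvertible (\<one>\<^sub>J + x)"
proof (rule jinvertible_if_bij_U_op, rule bij_if_near_id[OF linear_U_op])
  \<comment> \<open>The constant is 2 * (1/4) + 3 * (1/4)^2 = 11/16, from the linear and the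
    quadratic part of U in \<open>x\<close>.\<close>
  show "norm (U_op (\<one>\<^sub>J + x) y - y) \<le> 11/16 * norm y" for y
  proof -
    have "norm (U_op (\<one>\<^sub>J + x) y - y) \<le> 2 * norm (x \<circ>\<^sub>J y) + norm (U_op x y)"
      unfolding U_op_junit_plus by norm
    also have "\<dots> \<le> 2 * (1/4 * norm y) + 3 * (1/4)\<^sup>2 * norm y"
    proof (intro add_mono mult_left_mono)
      show "norm (x \<circ>\<^sub>J y) \<le> 1/4 * norm y"
        by (rule order_trans[OF norm_jprod_le mult_right_mono]) (use assms in auto)
      show "norm (U_op x y) \<le> 3 * (1/4)\<^sup>2 * norm y"
        by (rule order_trans[OF norm_U_op_le])
          (use assms in \<open>auto intro!: mult_right_mono mult_left_mono power_mono\<close>)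
    qed auto
    finally show ?thesis by (simp add: power2_eq_square)
  qed
qed simp

lemma continuous_on_U_op: "continuous_on A (\<lambda>a. U_op a x)"
  unfolding U_op_eq by (intro continuous_intros jprod.continuous_on)

text \<open>The continuous map sending x to U_x(b^2) takes the value \<open>\<one>\<^sub>J\<close>
  at \<open>a\<close>. Near \<open>a\<close> its values are therefore invertible, and then so is
  x.\<close>

lemma open_jinvertibles: "open (jinvertibles :: 'a::unital_complex_jordan_banach set)"
proof (subst open_subopen, intro ballI)
  fix a :: 'a assume "a \<in> jinvertibles"
  then obtain b where b: "is_jinverse a b" by (auto simp: jinvertibles_def jinvertible_def)
  define V where "V = (\<lambda>x. U_op x (b \<circ>\<^sub>J b)) -` ball \<one>\<^sub>J (1/4)"
  have "open V" unfolding V_def by (intro open_vimage continuous_on_U_op open_ball)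
  moreover have "a \<in> V" by (simp add: V_def is_jinverseD[OF b])
  moreover have "x \<in> jinvertibles" if "x \<in> V" for x
  proof -
    have "jinvertible (\<one>\<^sub>J + (U_op x (b \<circ>\<^sub>J b) - \<one>\<^sub>J))"
      by (rule jinvertible_junit_plus) (use that in \<open>simp add: V_def dist_norm norm_minus_commute\<close>)
    thus ?thesis by (auto simp: jinvertibles_def intro: jinvertible_if_U_op)
  qed
  ultimately show "\<exists>T. open T \<and> a \<in> T \<and> T \<subseteq> jinvertibles" by blast
qed

section \<open>Ideals and the McCrimmon radical\<close>

lemma csubspace_closed:
  assumes "csubspace J" "x \<in> J"
  shows csubspace_add: "y \<in> J \<Longrightarrow> x + y \<in> J"
    and csubspace_diff: "y \<in> J \<Longrightarrow> x - y \<in> J"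
    and csubspace_scaleR: "r *\<^sub>R x \<in> J"
    and csubspace_scaleC: "c *\<^sub>C x \<in> J"
proof -
  show "y \<in> J \<Longrightarrow> x + y \<in> J" "r *\<^sub>R x \<in> J" "c *\<^sub>C x \<in> J"
    using assms by (auto simp: csubspace_def scaleR_scaleC)
  have "x + (-1) *\<^sub>C y \<in> J" if "y \<in> J"
    using assms that unfolding csubspace_def by blast
  thus "x - y \<in> J" if "y \<in> J"
    using that scaleR_scaleC[of "-1" y] by (metis diff_conv_add_uminus of_real_1 of_real_minus scaleR_minus1_left)
qed

text \<open>Polarising U at the unit recovers the product: U_{1+a} x - x - U_a x is twice
  \<open>a \<circ>\<^sub>J x\<close>.\<close>

lemma jideal_jprod:
  assumes J: "jideal J" and x: "x \<in> J"
  shows "a \<circ>\<^sub>J x \<in> J" "x \<circ>\<^sub>J a \<in> J"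
proof -
  have "csubspace J" using J by (simp add: jideal_def)
  note sub = csubspace_closed[OF this]
  have U: "U_op b x \<in> J" for b using J x by (auto simp: jideal_def)
  have "(1/2) *\<^sub>R (U_op (\<one>\<^sub>J + a) x - x - U_op a x) \<in> J"
    by (intro sub U x)
  thus "a \<circ>\<^sub>J x \<in> J" by (simp add: U_op_junit_plus)
  thus "x \<circ>\<^sub>J a \<in> J" by (metis jprod_commute)
qed

lemma jidealI:
  assumes J: "csubspace J" and prod: "\<And>a x. x \<in> J \<Longrightarrow> a \<circ>\<^sub>J x \<in> J"
  shows "jideal J"
proof -
  have prod': "x \<circ>\<^sub>J a \<in> J" if "x \<in> J" for a x using prod[OF that] by (metis jprod_commute)
  show ?thesis unfolding jideal_def U_op_eq
    by (intro conjI allI ballI csubspace_diff[OF J] csubspace_scaleR[OF J] J) (simp_all add: prod prod')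
qed

text \<open>Expanding U_{a-x}(b^2) and using U_a(b^2) = 1 leaves the unit minus terms containing the
  factor \<open>x\<close>, which lie in \<open>J\<close>.\<close>

lemma jinvertible_diff_quasi_invertible_ideal:
  assumes J: "quasi_invertible_ideal J" and a: "jinvertible a" and x: "x \<in> J"
  shows "jinvertible (a - x)"
proof -
  have J': "jideal J" "csubspace J" using J by (auto simp: quasi_invertible_ideal_def jideal_def)
  obtain b where b: "is_jinverse a b" using a by (auto simp: jinvertible_def)
  let ?b2 = "b \<circ>\<^sub>J b"
  have "U_op (a - x) ?b2 = U_op a ?b2 - (2 *\<^sub>R jtriple a ?b2 x - U_op x ?b2)"
    by (simp add: U_op_eq_jtriple jtriple_linear jtriple_commute[of x _ a] scaleR_2)
  also have "\<dots> = \<one>\<^sub>J - (2 *\<^sub>R jtriple a ?b2 x - U_op x ?b2)"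
    by (simp add: is_jinverseD[OF b])
  finally have eq: "U_op (a - x) ?b2 = \<one>\<^sub>J - (2 *\<^sub>R jtriple a ?b2 x - U_op x ?b2)" .
  have "2 *\<^sub>R jtriple a ?b2 x - U_op x ?b2 \<in> J"
    unfolding jtriple_def U_op_eq by (intro csubspace_closed[OF J'(2)] jideal_jprod[OF J'(1)] x)
  hence "jinvertible (U_op (a - x) ?b2)"
    using J by (simp add: eq quasi_invertible_ideal_def quasi_invertible_def)
  thus ?thesis by (rule jinvertible_if_U_op)
qed

text \<open>Since 1 - (x + y) = (1 - x) - y, quasi-invertibility of the sum is a perturbation by
  \<open>J\<close> of the invertible element 1 - x.\<close>

lemma quasi_invertible_ideal_sum:
  assumes I: "quasi_invertible_ideal I" and J: "quasi_invertible_ideal J"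
  shows "quasi_invertible_ideal {x + y | x y. x \<in> I \<and> y \<in> J}" (is "quasi_invertible_ideal ?S")
proof -
  have id: "jideal I" "csubspace I" "jideal J" "csubspace J"
    using I J by (auto simp: quasi_invertible_ideal_def jideal_def)
  have "csubspace ?S"
    unfolding csubspace_def
  proof (intro conjI ballI allI)
    have "0 + 0 \<in> ?S" using id unfolding csubspace_def by blast
    thus "0 \<in> ?S" by simp
    show "c *\<^sub>C u \<in> ?S" if u: "u \<in> ?S" for c u
    proof -
      obtain x y where "u = x + y" "x \<in> I" "y \<in> J" using u by blast
      thus ?thesis using id scaleC_add_right[of c x y] by (auto intro: csubspace_scaleC)
    qed
    fix u v assume "u \<in> ?S" "v \<in> ?S"
    then obtain x y x' y' where *: "u = x + y" "v = x' + y'" "x \<in> I" "x' \<in> I" "y \<in> J" "y' \<in> J" by blast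
    hence "u + v = (x + x') + (y + y')" "x + x' \<in> I" "y + y' \<in> J" using id by (auto intro: csubspace_add)
    thus "u + v \<in> ?S" by blast
  qed
  hence "jideal ?S"
  proof (rule jidealI)
    fix a u assume "u \<in> ?S"
    then obtain x y where "u = x + y" "x \<in> I" "y \<in> J" by blast
    thus "a \<circ>\<^sub>J u \<in> ?S" using id by (auto simp: jprod.add_right intro: jideal_jprod)
  qed
  moreover have "quasi_invertible (x + y)" if "x \<in> I" "y \<in> J" for x y
    using jinvertible_diff_quasi_invertible_ideal[OF J, of "\<one>\<^sub>J - x" y] I that
    by (simp add: quasi_invertible_def quasi_invertible_ideal_def diff_diff_eq)
  ultimately show ?thesis by (auto simp: quasi_invertible_ideal_def)
qed

lemma jinvertible_junit: "jinvertible (\<one>\<^sub>J :: 'a::unital_complex_jordan_banach)"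
  using jinvertible_junit_plus[of "0::'a"] by simp

lemma quasi_invertible_ideal_zero: "quasi_invertible_ideal {0 :: 'a::unital_complex_jordan_banach}"
proof -
  have "c *\<^sub>C (0::'a) = 0" for c using scaleC_add_right[of c "0::'a" 0] by simp
  thus ?thesis
    by (auto simp: quasi_invertible_ideal_def quasi_invertible_def jinvertible_junit csubspace_def
        jprod.zero_right intro!: jidealI)
qed

text \<open>Justifies \<open>GREATEST\<close> in the definition: the union of all quasi-invertible
  ideals is again one, because two elements always lie in a common one, the sum.\<close>

lemma
  shows quasi_invertible_ideal_mccrimmon_radical:
      "quasi_invertible_ideal (mccrimmon_radical :: 'a::unital_complex_jordan_banach set)" (is ?A)
    and quasi_invertible_ideal_subset_mccrimmon_radical:
      "quasi_invertible_ideal J \<Longrightarrow> J \<subseteq> (mccrimmon_radical :: 'a set)" (is "_ \<Longrightarrow> ?B")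
proof -
  define R where "R = \<Union>{J :: 'a set. quasi_invertible_ideal J}"
  have "csubspace R"
    unfolding csubspace_def
  proof (intro conjI ballI allI)
    show "0 \<in> R" using quasi_invertible_ideal_zero by (auto simp: R_def)
    show "c *\<^sub>C x \<in> R" if "x \<in> R" for c x
      using that unfolding R_def quasi_invertible_ideal_def jideal_def
      by (blast intro: csubspace_scaleC)
    fix x y assume "x \<in> R" "y \<in> R"
    then obtain I J where IJ: "quasi_invertible_ideal I" "x \<in> I" "quasi_invertible_ideal J" "y \<in> J"
      by (auto simp: R_def)
    thus "x + y \<in> R" using quasi_invertible_ideal_sum[OF IJ(1,3)] unfolding R_def by blast
  qed
  hence "jideal R"
    by (rule jidealI) (auto simp: R_def quasi_invertible_ideal_def intro: jideal_jprod)
  hence R: "quasi_invertible_ideal R"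
    by (auto simp: quasi_invertible_ideal_def R_def)
  have "mccrimmon_radical = R"
    unfolding mccrimmon_radical_def by (rule Greatest_equality[of quasi_invertible_ideal, OF R]) (auto simp: R_def)
  thus ?A "quasi_invertible_ideal J \<Longrightarrow> ?B" using R by (auto simp: R_def)
qed

section \<open>A local Mazur--Ulam theorem\<close>

lemma surjective_isometry_inj_on:
  assumes "surjective_isometry f A B"
  shows "inj_on f A"
proof (rule inj_onI)
  fix x y assume "x \<in> A" "y \<in> A" "f x = f y"
  thus "x = y" using assms unfolding surjective_isometry_def by (metis norm_eq_zero right_minus_eq)
qed

lemma surjective_isometry_inv_into:
  assumes f: "surjective_isometry f A B"
  shows "surjective_isometry (inv_into A f) B A"
proof -
  have im: "f ` A = B" using f by (simp add: surjective_isometry_def)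
  have "inv_into A f ` B = A"
    using surjective_isometry_inj_on[OF f] im by (metis inv_into_image_cancel subset_refl)
  moreover have "norm (inv_into A f x - inv_into A f y) = norm (x - y)" if "x \<in> B" "y \<in> B" for x y
  proof -
    have "inv_into A f x \<in> A" "inv_into A f y \<in> A" "f (inv_into A f x) = x" "f (inv_into A f y) = y"
      using that im by (auto intro: inv_into_into f_inv_into_f)
    thus ?thesis using f unfolding surjective_isometry_def by metis
  qed
  ultimately show ?thesis by (simp add: surjective_isometry_def)
qed

lemma surjective_isometry_comp:
  assumes "surjective_isometry f A B" "surjective_isometry g B C"
  shows "surjective_isometry (\<lambda>x. g (f x)) A C"
  using assms unfolding surjective_isometry_def by (auto simp: image_iff) 

lemma surjective_isometry_reflection:
  fixes c :: "'a::real_normed_vector"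
  assumes "\<And>u. u \<in> A \<Longrightarrow> 2 *\<^sub>R c - u \<in> A"
  shows "surjective_isometry (\<lambda>u. 2 *\<^sub>R c - u) A A"
proof -
  have "u \<in> (\<lambda>u. 2 *\<^sub>R c - u) ` A" if "u \<in> A" for u
    by (rule image_eqI[of _ _ "2 *\<^sub>R c - u"]) (use assms that in auto)
  thus ?thesis using assms by (auto simp: surjective_isometry_def norm_minus_commute)
qed

text \<open>Vaisala's proof of the Mazur--Ulam theorem: if \<open>g\<close> moves the centre by \<open>\<delta>\<close>, then
  conjugating by the reflection yields an isometry moving it by \<open>2\<delta>\<close>.\<close>

lemma surjective_isometry_fixes_centre:
  fixes c :: "'a::real_normed_vector"
  assumes bdd: "bounded A" and c: "c \<in> A" and sym: "\<And>u. u \<in> A \<Longrightarrow> 2 *\<^sub>R c - u \<in> A"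
    and g: "surjective_isometry g A A"
  shows "g c = c"
proof -
  obtain K where K: "\<And>u. u \<in> A \<Longrightarrow> norm u \<le> K" using bdd by (auto simp: bounded_iff)
  define \<Lambda> where "\<Lambda> = {norm (h c - c) | h. surjective_isometry h A A}"
  have bound: "bdd_above \<Lambda>"
  proof (rule bdd_aboveI)
    fix r assume "r \<in> \<Lambda>"
    then obtain h where h: "r = norm (h c - c)" "surjective_isometry h A A" by (auto simp: \<Lambda>_def)
    hence "h c \<in> A" using c by (auto simp: surjective_isometry_def)
    thus "r \<le> 2 * K" using K[of "h c"] K[OF c] norm_triangle_ineq4[of "h c" c] h(1) by linarith
  qed
  have double: "2 * r \<le> Sup \<Lambda>" if r: "r \<in> \<Lambda>" for r
  proof -
    obtain h where h: "r = norm (h c - c)" "surjective_isometry h A A"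
      using r unfolding \<Lambda>_def by blast
    let ?\<psi> = "\<lambda>u. 2 *\<^sub>R c - u" and ?k = "inv_into A h"
    let ?h' = "\<lambda>u. ?\<psi> (?k (?\<psi> (h u)))"
    have k: "surjective_isometry ?k A A" by (rule surjective_isometry_inv_into[OF h(2)])
    have \<psi>: "surjective_isometry ?\<psi> A A" by (rule surjective_isometry_reflection[OF sym])
    have "surjective_isometry ?h' A A"
      by (rule surjective_isometry_comp[OF surjective_isometry_comp[OF surjective_isometry_comp[OF h(2) \<psi>] k] \<psi>])
    hence "norm (?h' c - c) \<le> Sup \<Lambda>" by (intro cSup_upper bound) (auto simp: \<Lambda>_def)
    moreover have hc: "h c \<in> A" using h(2) c by (auto simp: surjective_isometry_def)
    have "norm (?h' c - c) = norm (?k (?\<psi> (h c)) - ?k (h c))"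
      using surjective_isometry_inj_on[OF h(2)] c
      by (simp add: scaleR_2 norm_minus_commute)
    also have "\<dots> = norm (?\<psi> (h c) - h c)"
      using k sym[OF hc] hc unfolding surjective_isometry_def by blast
    also have "\<dots> = norm (2 *\<^sub>R (c - h c))" by (simp add: scaleR_2 algebra_simps)
    also have "\<dots> = 2 * r" by (simp add: h(1) norm_minus_commute)
    finally show ?thesis using \<open>norm (?h' c - c) \<le> Sup \<Lambda>\<close> by simp
  qed
  have r: "norm (g c - c) \<in> \<Lambda>" using g by (auto simp: \<Lambda>_def)
  have "Sup \<Lambda> \<le> Sup \<Lambda> / 2"
    by (rule cSup_least) (use r double in force)+
  hence "norm (g c - c) \<le> 0" using cSup_upper[OF r bound] by linarith
  thus ?thesis by simp
qed

text \<open>Composing \<open>f\<close>, the reflection in \<open>d\<close>, the inverse of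
  \<open>f\<close> and the reflection in \<open>c\<close> gives a self-isometry of \<open>A\<close>.
  As it fixes \<open>c\<close>, the point \<open>f c\<close> is fixed by the reflection in
  \<open>d\<close>.\<close>

lemma surjective_isometry_centre:
  fixes c :: "'a::real_normed_vector" and d :: "'b::real_normed_vector"
  assumes f: "surjective_isometry f A B" and bdd: "bounded A" and c: "c \<in> A"
    and symA: "\<And>u. u \<in> A \<Longrightarrow> 2 *\<^sub>R c - u \<in> A" and symB: "\<And>v. v \<in> B \<Longrightarrow> 2 *\<^sub>R d - v \<in> B"
  shows "f c = d"
proof -
  let ?g = "\<lambda>u. 2 *\<^sub>R c - inv_into A f (2 *\<^sub>R d - f u)"
  have "surjective_isometry ?g A A"
    by (rule surjective_isometry_comp[OF surjective_isometry_comp[OF surjective_isometry_comp[OF f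
          surjective_isometry_reflection[OF symB]] surjective_isometry_inv_into[OF f]]
          surjective_isometry_reflection[OF symA]])
  from surjective_isometry_fixes_centre[OF bdd c symA this] have "?g c = c" .
  hence *: "inv_into A f (2 *\<^sub>R d - f c) = c" by (simp add: scaleR_2 algebra_simps)
  have "f c \<in> B" using f c by (auto simp: surjective_isometry_def)
  hence "f (inv_into A f (2 *\<^sub>R d - f c)) = 2 *\<^sub>R d - f c"
    using f symB by (intro f_inv_into_f) (auto simp: surjective_isometry_def)
  hence "2 *\<^sub>R f c = 2 *\<^sub>R d" unfolding * by (simp add: scaleR_2 algebra_simps)
  thus ?thesis by simp
qed

text \<open>The metric midpoints of x and y. There may be many of them, but the set is described by
  distances alone and is symmetric about the linear midpoint.\<close>

definition midset :: "'a::real_normed_vector \<Rightarrow> 'a \<Rightarrow> 'a set" where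
  "midset x y = {u. norm (u - x) = norm (x - y) / 2 \<and> norm (u - y) = norm (x - y) / 2}"

lemma midpoint_in_midset: "midpoint x y \<in> midset x y"
  by (simp add: midset_def dist_midpoint flip: dist_norm)

lemma midset_sym: "u \<in> midset x y \<Longrightarrow> 2 *\<^sub>R midpoint x y - u \<in> midset x y"
  by (auto simp: midset_def midpoint_def scaleR_2 algebra_simps norm_minus_commute)

text \<open>The two inclusions make the argument local: they ensure that \<open>f\<close> maps one
  set of metric midpoints onto the other.\<close>

lemma surjective_isometry_midpoint:
  fixes f :: "'a::real_normed_vector \<Rightarrow> 'b::real_normed_vector"
  assumes f: "surjective_isometry f U V" and xy: "x \<in> U" "y \<in> U"
    and U: "midset x y \<subseteq> U" and V: "midset (f x) (f y) \<subseteq> V"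
  shows "f (midpoint x y) = midpoint (f x) (f y)"
proof (rule surjective_isometry_centre[OF _ _ midpoint_in_midset midset_sym midset_sym])
  have iso: "norm (f a - f b) = norm (a - b)" if "a \<in> U" "b \<in> U" for a b
    using f that by (auto simp: surjective_isometry_def)
  have mem: "f u \<in> midset (f x) (f y) \<longleftrightarrow> u \<in> midset x y" if "u \<in> U" for u
    using that xy by (simp add: midset_def iso)
  have "f ` midset x y = midset (f x) (f y)"
  proof
    show "f ` midset x y \<subseteq> midset (f x) (f y)" using U mem by blast
    show "midset (f x) (f y) \<subseteq> f ` midset x y"
    proof
      fix v assume v: "v \<in> midset (f x) (f y)"
      hence "v \<in> f ` U" using V f by (auto simp: surjective_isometry_def)
      thus "v \<in> f ` midset x y" using v mem by auto
    qed
  qed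
  thus "surjective_isometry f (midset x y) (midset (f x) (f y))"
    using U iso unfolding surjective_isometry_def by blast
  have "midset x y \<subseteq> cball x (norm (x - y) / 2)"
    by (auto simp: midset_def dist_norm norm_minus_commute)
  thus "bounded (midset x y)" by (rule bounded_subset[OF bounded_cball])
qed

section \<open>From midpoints to real-linear maps\<close>

text \<open>Additivity gives integer homogeneity. Splitting \<open>n * r\<close> into integer and
  fractional part bounds n times the defect of homogeneity independently of n.\<close>

lemma linear_if_additive_bounded:
  fixes T :: "'a::real_normed_vector \<Rightarrow> 'b::real_normed_vector"
  assumes add: "\<And>x y. T (x + y) = T x + T y" and bdd: "\<And>x. norm (T x) \<le> C * norm x"
  shows "linear T"
proof (rule linearI[OF add])
  fix r x
  have T0: "T 0 = 0" using add[of 0 0] by simp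
  have Tm: "T (- y) = - T y" for y using add[of y "- y"] T0 by (simp add: eq_neg_iff_add_eq_0 add.commute)
  have nat: "T (real n *\<^sub>R y) = real n *\<^sub>R T y" for n y
    by (induction n) (simp_all add: T0 add scaleR_left.add)
  have int: "T (of_int k *\<^sub>R y) = of_int k *\<^sub>R T y" for k y
  proof (cases k rule: int_cases2)
    case (nonneg n) thus ?thesis using nat by simp
  next
    case (nonpos n) thus ?thesis using nat[of n y] Tm by simp
  qed
  define d where "d = T (r *\<^sub>R x) - r *\<^sub>R T x"
  have C: "0 \<le> C * norm x" using bdd[of x] norm_ge_zero[of "T x"] by linarith
  have "real n * norm d \<le> 2 * (C * norm x)" for n
  proof -
    define k where "k = \<lfloor>real n * r\<rfloor>"
    define s where "s = real n * r - of_int k"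
    have s: "0 \<le> s" "s \<le> 1" unfolding s_def k_def by linarith+
    have nr: "real n * r = s + of_int k" by (simp add: s_def)
    have "real n *\<^sub>R d = T ((s + of_int k) *\<^sub>R x) - (s + of_int k) *\<^sub>R T x"
      using nat[of n "r *\<^sub>R x"] by (simp add: d_def scaleR_diff_right nr)
    also have "\<dots> = T (s *\<^sub>R x) - s *\<^sub>R T x"
      by (simp add: scaleR_left.add add int)
    finally have "real n * norm d = norm (T (s *\<^sub>R x) - s *\<^sub>R T x)"
      by (metis abs_of_nat norm_scaleR)
    also have "\<dots> \<le> norm (T (s *\<^sub>R x)) + norm (s *\<^sub>R T x)" by (rule norm_triangle_ineq4)
    also have "\<dots> \<le> s * (C * norm x) + s * (C * norm x)"
    proof (rule add_mono)
      show "norm (T (s *\<^sub>R x)) \<le> s * (C * norm x)"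
        using bdd[of "s *\<^sub>R x"] s by (simp add: mult_ac)
      show "norm (s *\<^sub>R T x) \<le> s * (C * norm x)"
        using mult_left_mono[OF bdd[of x] s(1)] s by simp
    qed
    also have "\<dots> \<le> 2 * (C * norm x)" using mult_right_mono[OF s(2) C] by linarith
    finally show ?thesis .
  qed
  hence "norm d \<le> 0"
    by (metis linorder_not_le reals_Archimedean3)
  thus "T (r *\<^sub>R x) = r *\<^sub>R T x" by (simp add: d_def)
qed

text \<open>\<open>g\<close> commutes with halving near 0, so 2^n g(x / 2^n) does not depend on n
  once it is large enough for x; this value is \<open>T x\<close>.\<close>

lemma midpoint_affine_extends:
  fixes g :: "'a::real_normed_vector \<Rightarrow> 'b::real_normed_vector"
  assumes \<epsilon>: "\<epsilon> > 0" and g0: "g 0 = 0" and iso: "\<And>x. norm x < \<epsilon> \<Longrightarrow> norm (g x) = norm x"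
    and mid: "\<And>x y. norm x < \<epsilon> \<Longrightarrow> norm y < \<epsilon> \<Longrightarrow> g (midpoint x y) = midpoint (g x) (g y)"
  obtains T where "linear T" "\<And>x. norm (T x) = norm x" "\<And>x. norm x < \<epsilon> \<Longrightarrow> g x = T x"
proof -
  have half: "g ((1/2) *\<^sub>R x) = (1/2) *\<^sub>R g x" if "norm x < \<epsilon>" for x
    using mid[of x 0] that \<epsilon> by (simp add: midpoint_def g0)
  define h where "h n x = 2 ^ n *\<^sub>R g ((1 / 2 ^ n) *\<^sub>R x)" for n :: nat and x
  have small: "norm ((1 / 2 ^ n) *\<^sub>R x) < \<epsilon> \<longleftrightarrow> norm x < 2 ^ n * \<epsilon>" for n :: nat and x :: 'a
    by (simp add: field_simps)
  have step: "h (Suc n) x = h n x" if "norm x < 2 ^ n * \<epsilon>" for n x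
    using half[OF small[THEN iffD2, OF that]] by (simp add: h_def)
  have mono: "2 ^ n * \<epsilon> \<le> 2 ^ m * \<epsilon>" if "n \<le> m" for n m :: nat
    using that \<epsilon> by (simp add: power_increasing)
  have h_mono: "h m x = h n x" if "n \<le> m" "norm x < 2 ^ n * \<epsilon>" for n m x
    using that(1)
  proof (induction m rule: dec_induct)
    case (step m)
    have "norm x < 2 ^ m * \<epsilon>" using mono[OF step(1)] that(2) by simp
    thus ?case using \<open>h m x = h n x\<close> \<open>\<And>n x. norm x < 2 ^ n * \<epsilon> \<Longrightarrow> h (Suc n) x = h n x\<close> by simp
  qed simp
  have ex: "\<exists>n. norm x < 2 ^ n * \<epsilon>" for x :: 'a
  proof -
    obtain n where "norm x / \<epsilon> < 2 ^ n" using real_arch_pow[of 2 "norm x / \<epsilon>"] by auto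
    thus ?thesis using \<epsilon> by (auto simp: field_simps)
  qed
  define N where "N x = (SOME n. norm x < 2 ^ n * \<epsilon>)" for x :: 'a
  have N: "norm x < 2 ^ N x * \<epsilon>" for x unfolding N_def by (rule someI_ex[OF ex])
  define T where "T x = h (N x) x" for x
  have T: "T x = h n x" if "norm x < 2 ^ n * \<epsilon>" for n x
    using h_mono[OF _ N, of x "max (N x) n"] h_mono[OF _ that, of "max (N x) n"] by (simp add: T_def)
  have Tg: "g x = T x" if "norm x < \<epsilon>" for x
    using T[of x 0] that by (simp add: h_def)
  have Tnorm: "norm (T x) = norm x" for x
  proof -
    have "norm (g ((1 / 2 ^ N x) *\<^sub>R x)) = norm ((1 / 2 ^ N x) *\<^sub>R x)"
      by (rule iso) (simp only: small N)
    thus ?thesis by (simp add: T_def h_def)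
  qed
  have Tadd: "T (x + y) = T x + T y" for x y
  proof -
    define n where "n = max (N x) (max (N y) (N (x + y)))"
    have n: "norm x < 2 ^ n * \<epsilon>" "norm y < 2 ^ n * \<epsilon>" "norm (x + y) < 2 ^ n * \<epsilon>"
      using N[of x] N[of y] N[of "x + y"] mono[of _ n] by (auto simp: n_def intro: order_less_le_trans)
    \<comment> \<open>One level higher, because (x + y) / 2^(n+1) is the midpoint of x / 2^n and y /
      2^n.\<close>
    have "norm (x + y) < 2 ^ Suc n * \<epsilon>" using order_less_le_trans[OF n(3) mono[of n "Suc n"]] by simp
    hence "T (x + y) = h (Suc n) (x + y)" by (rule T)
    also have "\<dots> = 2 ^ Suc n *\<^sub>R g (midpoint ((1 / 2 ^ n) *\<^sub>R x) ((1 / 2 ^ n) *\<^sub>R y))"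
      by (simp add: h_def midpoint_def scaleR_add_right)
    also have "\<dots> = h n x + h n y"
      using n by (subst mid) (simp_all only: small, simp add: h_def midpoint_def scaleR_add_right)
    finally show ?thesis using T n by simp
  qed
  have "linear T" by (rule linear_if_additive_bounded[OF Tadd, of 1]) (simp add: Tnorm)
  thus ?thesis using that Tnorm Tg by blast
qed

lemma surjective_isometry_locally_affine:
  fixes f :: "'a::real_normed_vector \<Rightarrow> 'b::real_normed_vector"
  assumes f: "surjective_isometry f U V" and "open U" "open V" and p: "p \<in> U"
  obtains \<epsilon> T where "\<epsilon> > 0" "linear T" "\<And>x. norm (T x) = norm x" "surj T"
    "ball p \<epsilon> \<subseteq> U" "\<And>q. q \<in> ball p \<epsilon> \<Longrightarrow> f q = f p + T (q - p)"
proof -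
  have iso: "norm (f a - f b) = norm (a - b)" if "a \<in> U" "b \<in> U" for a b
    using f that by (auto simp: surjective_isometry_def)
  have im: "f ` U = V" using f by (simp add: surjective_isometry_def)
  obtain \<delta>1 where \<delta>1: "\<delta>1 > 0" "ball p \<delta>1 \<subseteq> U" using \<open>open U\<close> p by (meson open_contains_ball)
  obtain \<delta>2 where \<delta>2: "\<delta>2 > 0" "ball (f p) \<delta>2 \<subseteq> V"
    using \<open>open V\<close> p im by (meson image_eqI open_contains_ball imageI)
  \<comment> \<open>Metric midpoints of two points within \<epsilon> of a centre lie within 2 *
    \<epsilon> of it, still inside the given balls.\<close>
  define \<epsilon> where "\<epsilon> = min \<delta>1 \<delta>2 / 4"
  have \<epsilon>: "\<epsilon> > 0" using \<delta>1 \<delta>2 by (simp add: \<epsilon>_def)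
  have sub: "ball p (2 * \<epsilon>) \<subseteq> U" "ball (f p) (2 * \<epsilon>) \<subseteq> V"
    using \<delta>1 \<delta>2 by (auto simp: \<epsilon>_def)
  have midset_sub: "midset u v \<subseteq> ball w (2 * \<epsilon>)" if "norm (u - w) < \<epsilon>" "norm (v - w) < \<epsilon>"
    for u v w :: "'c::real_normed_vector"
  proof
    fix z assume "z \<in> midset u v"
    hence "norm (z - u) = norm (u - v) / 2" by (simp add: midset_def)
    moreover have "norm (u - v) \<le> norm (u - w) + norm (v - w)" by norm
    moreover have "norm (z - w) \<le> norm (z - u) + norm (u - w)" by norm
    ultimately have "norm (z - w) < 2 * \<epsilon>" using that by linarith
    thus "z \<in> ball w (2 * \<epsilon>)" by (simp add: dist_norm norm_minus_commute)
  qed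
  define g where "g x = f (p + x) - f p" for x
  have pU: "p + x \<in> U" if "norm x < \<epsilon>" for x
    using sub(1) that \<epsilon> by (auto simp: dist_norm)
  have iso_p: "norm (f (p + x) - f p) = norm x" if "norm x < \<epsilon>" for x
    using iso[OF pU[OF that] p] by simp
  have mid: "g (midpoint x y) = midpoint (g x) (g y)" if x: "norm x < \<epsilon>" and y: "norm y < \<epsilon>" for x y
  proof -
    have "f (midpoint (p + x) (p + y)) = midpoint (f (p + x)) (f (p + y))"
    proof (rule surjective_isometry_midpoint[OF f pU[OF x] pU[OF y]])
      show "midset (p + x) (p + y) \<subseteq> U"
        using midset_sub[of "p + x" p "p + y"] x y sub(1) by auto
      show "midset (f (p + x)) (f (p + y)) \<subseteq> V"
        using midset_sub[of "f (p + x)" "f p" "f (p + y)"] iso_p x y sub(2) by auto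
    qed
    moreover have "midpoint (p + x) (p + y) = p + midpoint x y"
      "midpoint (f (p + x)) (f (p + y)) - f p = midpoint (f (p + x) - f p) (f (p + y) - f p)"
      by (simp_all add: midpoint_def algebra_simps flip: scaleR_left.add)
    ultimately show ?thesis by (simp add: g_def)
  qed
  obtain T where T: "linear T" "\<And>x. norm (T x) = norm x" "\<And>x. norm x < \<epsilon> \<Longrightarrow> g x = T x"
    by (rule midpoint_affine_extends[of \<epsilon> g, OF \<epsilon> _ _ mid]) (auto simp: g_def iso_p)
  have Tf: "f q = f p + T (q - p)" if "q \<in> ball p \<epsilon>" for q
  proof -
    have "f q - f p = T (q - p)"
      using T(3)[of "q - p"] that by (simp add: g_def dist_norm norm_minus_commute)
    thus ?thesis by (metis add.commute diff_add_cancel)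
  qed
  \<comment> \<open>Surjectivity comes from openness of \<open>V\<close>: a small multiple of
    \<open>v\<close> added to \<open>f p\<close> has a preimage within \<epsilon> of
    \<open>p\<close>.\<close>
  have "v \<in> range T" for v
  proof -
    define r where "r = \<epsilon> / (1 + norm v)"
    have r: "r > 0" "norm (r *\<^sub>R v) < \<epsilon>" using \<epsilon> by (auto simp: r_def field_simps add_pos_nonneg)
    hence "f p + r *\<^sub>R v \<in> V" using sub(2) \<epsilon> by (auto simp: dist_norm)
    then obtain u where u: "u \<in> U" "f u = f p + r *\<^sub>R v" using im by auto
    have "norm (u - p) < \<epsilon>" using iso[OF u(1) p] u(2) r by simp
    hence "T (u - p) = r *\<^sub>R v" using Tf[of u] u(2) by (simp add: dist_norm norm_minus_commute)
    hence "T ((1 / r) *\<^sub>R (u - p)) = v" using r by (simp add: linear_scale[OF T(1)])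
    thus ?thesis by blast
  qed
  hence "surj T" by blast
  moreover have "ball p \<epsilon> \<subseteq> U" using sub(1) \<epsilon> by (auto simp: subset_eq)
  ultimately show ?thesis using that \<epsilon> T Tf by blast
qed

lemma linear_eq_if_eq_near_0:
  fixes S T :: "'a::real_normed_vector \<Rightarrow> 'b::real_vector"
  assumes "linear S" "linear T" "r > 0" and eq: "\<And>x. norm x < r \<Longrightarrow> S x = T x"
  shows "S = T"
proof
  fix x :: 'a
  define s where "s = r / (1 + norm x)"
  have s: "s > 0" "norm (s *\<^sub>R x) < r" using \<open>r > 0\<close> by (auto simp: s_def field_simps add_pos_nonneg)
  thus "S x = T x" using eq[OF s(2)] by (simp add: linear_scale[OF \<open>linear S\<close>] linear_scale[OF \<open>linear T\<close>])
qed

text \<open>The pair of linear part and intercept of the local affine expression is locally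
  constant, hence constant on \<open>W\<close>.\<close>

theorem surjective_isometry_affine_on_connected:
  fixes f :: "'a::real_normed_vector \<Rightarrow> 'b::real_normed_vector"
  assumes f: "surjective_isometry f U V" and "open U" "open V"
    and W: "connected W" "W \<subseteq> U" "W \<noteq> {}"
  obtains T u where "linear T" "\<And>x. norm (T x) = norm x" "surj T" "\<And>x. x \<in> W \<Longrightarrow> f x = T x + u"
proof -
  define P where "P p \<epsilon> T \<longleftrightarrow> \<epsilon> > 0 \<and> linear T \<and> (\<forall>x. norm (T x) = norm x) \<and> surj T \<and>
    ball p \<epsilon> \<subseteq> U \<and> (\<forall>q\<in>ball p \<epsilon>. f q = f p + T (q - p))" for p \<epsilon> T
  have "\<exists>\<epsilon> T. P p \<epsilon> T" if "p \<in> U" for p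
    using surjective_isometry_locally_affine[OF assms(1-3) that] unfolding P_def by metis
  then obtain \<epsilon> T where PT: "\<And>p. p \<in> U \<Longrightarrow> P p (\<epsilon> p) (T p)" by metis
  have lin: "linear (T p)" if "p \<in> U" for p using PT[OF that] by (simp add: P_def)
  have near: "(T q, f q - T q q) = (T p, f p - T p p)" if p: "p \<in> U" and q: "q \<in> ball p (\<epsilon> p)" for p q
  proof -
    have "q \<in> U" using PT[OF p] q by (auto simp: P_def)
    note Pp = PT[OF p, unfolded P_def] and Pq = PT[OF \<open>q \<in> U\<close>, unfolded P_def]
    have fq: "f q = f p + T p (q - p)" using Pp q by blast
    obtain r where r: "r > 0" "ball q r \<subseteq> ball p (\<epsilon> p)" using q by (meson open_ball open_contains_ball)
    have "T q = T p"
    proof (rule linear_eq_if_eq_near_0[OF lin[OF \<open>q \<in> U\<close>] lin[OF p], of "min r (\<epsilon> q)"])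
      show "0 < min r (\<epsilon> q)" using r Pq by simp
      fix x :: 'a assume x: "norm x < min r (\<epsilon> q)"
      hence "q + x \<in> ball q r" "q + x \<in> ball q (\<epsilon> q)" by (auto simp: dist_norm)
      hence "f (q + x) = f q + T q (q + x - q)" "f (q + x) = f p + T p (q + x - p)"
        using Pq Pp r by blast+
      moreover have "T p (q + x - p) = T p (q - p) + T p x"
        by (simp add: linear_add[OF lin[OF p]] linear_diff[OF lin[OF p]])
      ultimately show "T q x = T p x" using fq by simp
    qed
    thus ?thesis using fq by (simp add: linear_diff[OF lin[OF p]])
  qed
  obtain p where p: "p \<in> W" using W by blast
  have "(T q, f q - T q q) = (T p, f p - T p p)" if "q \<in> W" for q
  proof (rule connected_local_const[OF W(1) that p, rule_format])
    fix a assume a: "a \<in> W"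
    hence a': "a \<in> U" "\<epsilon> a > 0" using W PT by (auto simp: P_def)
    have "eventually (\<lambda>b. b \<in> ball a (\<epsilon> a)) (at a within W)"
      using a'(2) unfolding eventually_at_topological by (intro exI[of _ "ball a (\<epsilon> a)"]) auto
    thus "eventually (\<lambda>b. (T a, f a - T a a) = (T b, f b - T b b)) (at a within W)"
      by eventually_elim (metis near[OF a'(1)])
  qed
  hence "f q = T p q + (f p - T p p)" if "q \<in> W" for q
    using that by (metis Pair_inject diff_add_cancel add.commute)
  thus ?thesis using that PT[of p] p W(2) unfolding P_def by blast
qed

section \<open>Clopen quadratic sets\<close>

lemma scaleC_zero_right [simp]: "c *\<^sub>C (0::'a::complex_banach) = 0"
  using scaleC_add_right[of c 0 "0::'a"] by simp

lemma scaleC_zero_left [simp]: "0 *\<^sub>C (x::'a::complex_banach) = 0"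
  using scaleC_add_left[of 0 0 x] by simp

lemma scaleC_sum_right: "c *\<^sub>C (\<Sum>i\<in>A. f i) = (\<Sum>i\<in>A. c *\<^sub>C (f i :: 'a::complex_banach))"
  by (induction A rule: infinite_finite_induct) (simp_all add: scaleC_add_right)

lemma scaleC_sum_left: "(\<Sum>i\<in>A. f i) *\<^sub>C (x::'a::complex_banach) = (\<Sum>i\<in>A. f i *\<^sub>C x)"
  by (induction A rule: infinite_finite_induct) (simp_all add: scaleC_add_left)

lemma bounded_bilinear_scaleC: "bounded_bilinear (scaleC :: complex \<Rightarrow> 'a::complex_banach \<Rightarrow> 'a)"
proof
  fix r c and x :: 'a
  show "(r *\<^sub>R c) *\<^sub>C x = r *\<^sub>R (c *\<^sub>C x)" "c *\<^sub>C (r *\<^sub>R x) = r *\<^sub>R (c *\<^sub>C x)"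
    by (simp_all add: scaleR_scaleC scaleC_scaleC scaleR_conv_of_real mult.commute)
  show "\<exists>K. \<forall>c (x::'a). norm (c *\<^sub>C x) \<le> norm c * norm x * K"
    by (intro exI[of _ 1]) (simp add: norm_scaleC)
qed (simp_all add: scaleC_add_left scaleC_add_right)

lemmas continuous_on_scaleC = bounded_bilinear.continuous_on[OF bounded_bilinear_scaleC]

text \<open>The coefficient of z^k in the n-th power of 1 + z d, given by Pascal's recursion; it
  equals (n choose k) times \<open>jpow d k\<close>.\<close>

fun jcoeff :: "'a::unital_complex_jordan_banach \<Rightarrow> nat \<Rightarrow> nat \<Rightarrow> 'a" where
  "jcoeff d 0 k = (if k = 0 then \<one>\<^sub>J else 0)"
| "jcoeff d (Suc n) 0 = jcoeff d n 0"
| "jcoeff d (Suc n) (Suc k) = jcoeff d n (Suc k) + d \<circ>\<^sub>J jcoeff d n k"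

lemma jcoeff_eq_0: "k > n \<Longrightarrow> jcoeff d n k = 0"
  by (induction d n k rule: jcoeff.induct) (auto simp: jprod.zero_right)

lemma jcoeff_0: "jcoeff d n 0 = \<one>\<^sub>J"
  by (induction n) auto

lemma jcoeff_1: "jcoeff d n 1 = real n *\<^sub>R d"
  by (induction n) (auto simp: jcoeff_0 scaleR_left.add)

lemma jpow_junit_plus:
  "jpow (\<one>\<^sub>J + z *\<^sub>C d) n = (\<Sum>k\<le>n. z ^ k *\<^sub>C jcoeff d n k)"
proof (induction n)
  case 0 thus ?case by (simp add: scaleC_one)
next
  case (Suc n)
  let ?f = "\<lambda>k. z ^ k *\<^sub>C jcoeff d n k"
  have "jpow (\<one>\<^sub>J + z *\<^sub>C d) (Suc n) = (\<Sum>k\<le>n. ?f k) + (\<Sum>k\<le>n. z ^ Suc k *\<^sub>C (d \<circ>\<^sub>J jcoeff d n k))"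
    by (simp add: Suc jprod.add_left jprod_scaleC_left jprod_scaleC_right jprod.sum_right
        scaleC_sum_right scaleC_add_right scaleC_scaleC sum.distrib mult.commute[of _ z])
  also have "(\<Sum>k\<le>n. ?f k) = ?f 0 + (\<Sum>k\<le>n. ?f (Suc k))"
    using sum.atMost_Suc_shift[of ?f n] by (simp add: jcoeff_eq_0)
  also have "\<dots> + (\<Sum>k\<le>n. z ^ Suc k *\<^sub>C (d \<circ>\<^sub>J jcoeff d n k)) =
      (\<Sum>k\<le>Suc n. z ^ k *\<^sub>C jcoeff d (Suc n) k)"
    by (subst sum.atMost_Suc_shift)
      (simp add: scaleC_add_right scaleC_scaleC sum.distrib mult.commute[of _ z])
  finally show ?case .
qed

lemma norm_jpow_le: "norm a \<le> 1 \<Longrightarrow> norm (jpow a n) \<le> 1"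
proof (induction n)
  case (Suc n)
  have "norm (a \<circ>\<^sub>J jpow a n) \<le> norm a * norm (jpow a n)" by (rule norm_jprod_le)
  also have "\<dots> \<le> 1 * 1" using Suc by (intro mult_mono) auto
  finally show ?case by simp
qed (simp add: norm_junit)

text \<open>The unit is an extreme point of the unit ball in the complex sense: averaging
  \<open>(\<one> + \<zeta>d)\<^sup>n\<close> against \<open>\<zeta>\<^sup>-\<^sup>1\<close> over roots of unity bounds \<open>n \<delta> \<parallel>d\<parallel>\<close> by \<open>1\<close> for all \<open>n\<close>.\<close>

lemma junit_complex_extreme:
  fixes d :: "'a::unital_complex_jordan_banach"
  assumes \<delta>: "\<delta> > 0" and le: "\<And>z. cmod z = \<delta> \<Longrightarrow> norm (\<one>\<^sub>J + z *\<^sub>C d) \<le> 1"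
  shows "d = 0"
proof -
  have bound: "real n * (\<delta> * norm d) \<le> 1" if n: "n \<ge> 1" for n
  proof -
    \<comment> \<open>With N = n + 1 nodes the exponents 0, ..., n are separated, and
      \<open>\<omega> (n * j)\<close> is the inverse of \<open>\<omega> j\<close> because n is -1
      modulo N.\<close>
    define N where "N = Suc n"
    define \<omega> where "\<omega> m = exp (2 * of_real pi * \<i> * of_nat m / of_nat N)" for m
    have \<omega>_add: "\<omega> (k + m) = \<omega> k * \<omega> m" for k m
      by (simp add: \<omega>_def ring_distribs add_divide_distrib flip: exp_add)
    have \<omega>_pow: "\<omega> (m * k) = \<omega> m ^ k" for m k
      by (simp add: \<omega>_def mult_ac flip: exp_of_nat_mult)
    have \<omega>_1: "\<omega> m = 1 \<longleftrightarrow> N dvd m" for m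
      using complex_root_unity_eq[of N m 0] by (simp add: \<omega>_def N_def mod_eq_0_iff_dvd)
    have cmod: "cmod (\<omega> m) = 1" for m
      by (simp add: \<omega>_def)
    have sum_\<omega>: "(\<Sum>j<N. \<omega> (m * j)) = (if N dvd m then of_nat N else 0)" for m
    proof (cases "N dvd m")
      case False
      have "(\<Sum>j<N. \<omega> (m * j)) = (\<Sum>j<N. \<omega> m ^ j)" by (simp add: \<omega>_pow)
      also have "\<dots> = (\<omega> m ^ N - 1) / (\<omega> m - 1)" using False \<omega>_1 by (intro geometric_sum) simp
      also have "\<omega> m ^ N = 1" using \<omega>_1[of "m * N"] by (simp flip: \<omega>_pow)
      finally show ?thesis using False by simp
    qed (use \<omega>_1[of m] in \<open>simp add: \<omega>_pow\<close>)
    have dvd: "N dvd n + k \<longleftrightarrow> k = 1" if "k \<le> n" for k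
    proof
      assume "N dvd n + k"
      then obtain q where q: "n + k = N * q" by blast
      have "q < 2"
        using q that by (intro ccontr[of "q < 2"])
          (auto simp: N_def not_less dest: mult_le_mono[of N N 2 q, simplified])
      hence "q = 0 \<or> q = 1" by auto
      thus "k = 1" using q n by (auto simp: N_def)
    qed (simp add: N_def)
    define S where "S = (\<Sum>j<N. \<omega> (n * j) *\<^sub>C jpow (\<one>\<^sub>J + (\<omega> j * of_real \<delta>) *\<^sub>C d) n)"
    have "S = (\<Sum>j<N. \<Sum>k\<le>n. \<omega> ((n + k) * j) *\<^sub>C (of_real (\<delta> ^ k) *\<^sub>C jcoeff d n k))"
      unfolding S_def jpow_junit_plus scaleC_sum_right scaleC_scaleC
      by (intro sum.cong refl arg_cong2[where f = scaleC])
        (simp add: power_mult_distrib ring_distribs \<omega>_add mult.commute[of _ "_::nat"] flip: \<omega>_pow)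
    also have "\<dots> = (\<Sum>k\<le>n. (\<Sum>j<N. \<omega> ((n + k) * j)) *\<^sub>C (of_real (\<delta> ^ k) *\<^sub>C jcoeff d n k))"
      unfolding scaleC_sum_left by (rule sum.swap)
    also have "\<dots> = (\<Sum>k\<le>n. if k = 1 then (of_nat N * of_real \<delta>) *\<^sub>C jcoeff d n 1 else 0)"
      unfolding sum_\<omega> by (intro sum.cong refl) (auto simp: dvd scaleC_scaleC)
    also have "\<dots> = (of_nat N * of_real \<delta>) *\<^sub>C (real n *\<^sub>R d)"
      using n by (simp add: jcoeff_1[unfolded One_nat_def])
    finally have "norm S = real N * (real n * (\<delta> * norm d))"
      using \<delta> by (simp add: norm_scaleC norm_mult mult_ac)
    moreover have "norm S \<le> (\<Sum>j<N. 1)"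
      unfolding S_def using \<delta>
      by (intro sum_norm_le) (auto simp: norm_scaleC cmod norm_mult intro!: norm_jpow_le le)
    ultimately show ?thesis by (simp add: N_def)
  qed
  show ?thesis
  proof (rule ccontr)
    assume "d \<noteq> 0"
    hence "\<delta> * norm d > 0" using \<delta> by simp
    then obtain n where "1 < real n * (\<delta> * norm d)" using reals_Archimedean3 by blast
    thus False using bound[of n] by (cases n) auto
  qed
qed

section \<open>Stability of clopen quadratic sets under scaling and translation\<close>

locale clopen_quadratic_set =
  fixes S :: "'a::unital_complex_jordan_banach set"
  assumes subset: "S \<subseteq> jinvertibles" and nonempty: "S \<noteq> {}"
    and clopen: "clopen_in_jinvertibles S" and quadratic: "quadratic_set S"
    and closed: "closed_powers_inverses S"
begin

lemma jinvertible: "a \<in> S \<Longrightarrow> jinvertible a"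
  using subset by (auto simp: jinvertibles_def)

lemma U_op_mem: "a \<in> S \<Longrightarrow> b \<in> S \<Longrightarrow> U_op a b \<in> S"
  using quadratic by (auto simp: quadratic_set_def)

lemma jinv_mem: "a \<in> S \<Longrightarrow> jinv a \<in> S"
  using closed by (auto simp: closed_powers_inverses_def)

lemma open_S: "open S"
  using clopen open_jinvertibles openin_open_trans by (auto simp: clopen_in_jinvertibles_def)

text \<open>Turns clopenness into a propagation principle: membership spreads along connected sets
  of invertible elements.\<close>

lemma connected_subset:
  assumes C: "connected C" "C \<subseteq> jinvertibles" and "a \<in> C" "a \<in> S"
  shows "C \<subseteq> S"
proof -
  obtain T where T: "open T" "S = jinvertibles \<inter> T"
    using clopen by (auto simp: clopen_in_jinvertibles_def openin_open)
  obtain T' where T': "closed T'" "S = jinvertibles \<inter> T'"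
    using clopen by (auto simp: clopen_in_jinvertibles_def closedin_closed)
  have "C \<inter> S = C \<inter> T" "C \<inter> S = C \<inter> T'" using C(2) T(2) T'(2) by auto
  hence "openin (top_of_set C) (C \<inter> S)" "closedin (top_of_set C) (C \<inter> S)"
    using T(1) T'(1) by (auto simp: openin_open closedin_closed)
  hence "C \<inter> S = {} \<or> C \<inter> S = C" using C(1) by (simp add: connected_clopen)
  thus ?thesis using assms(3,4) by blast
qed

text \<open>For c the inverse of a^2, U_a U_a c = U_{a^2} c = a^2 = U_a 1, and U_a can be
  cancelled.\<close>

lemma junit_mem: "\<one>\<^sub>J \<in> S"
proof -
  obtain a where a: "a \<in> S" using nonempty by blast
  have a2: "a \<circ>\<^sub>J a \<in> S"
    using closed a unfolding closed_powers_inverses_def by (metis jpow_2 one_le_numeral)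
  let ?c = "jinv (a \<circ>\<^sub>J a)"
  have "U_op a (U_op a ?c) = U_op a \<one>\<^sub>J"
    using is_jinverseD(1)[OF is_jinverse_jinv[OF jinvertible[OF a2]]]
    by (simp add: U_op_square U_op_junit_right)
  hence "U_op a ?c = \<one>\<^sub>J" using bij_U_op[OF jinvertible[OF a]] by (metis bij_is_inj injD)
  thus ?thesis using U_op_mem[OF a jinv_mem[OF a2]] by simp
qed

text \<open>The punctured complex plane is connected, unlike the punctured real line; so negative
  real factors are covered too.\<close>

lemma scaleC_mem:
  assumes "a \<in> S" "c \<noteq> 0"
  shows "c *\<^sub>C a \<in> S"
proof -
  let ?C = "(\<lambda>c. c *\<^sub>C a) ` (- {0})"
  have "connected (- {0::complex})" by (rule connected_punctured_universe) simp
  hence "connected ?C" by (intro connected_continuous_image continuous_on_scaleC continuous_intros)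
  moreover have "?C \<subseteq> jinvertibles"
    using jinvertible[OF assms(1)] by (auto simp: jinvertibles_def intro: jinvertible_scaleC)
  moreover have "a \<in> ?C" by (rule image_eqI[of _ _ 1]) (simp_all add: scaleC_one)
  ultimately have "?C \<subseteq> S" using assms(1) by (rule connected_subset)
  thus ?thesis using assms(2) by blast
qed

lemma scaleR_mem: "a \<in> S \<Longrightarrow> r \<noteq> 0 \<Longrightarrow> r *\<^sub>R a \<in> S"
  unfolding scaleR_scaleC by (rule scaleC_mem) simp_all

lemma junit_plus_mem:
  assumes "norm x < 1/4"
  shows "\<one>\<^sub>J + x \<in> S"
proof -
  let ?C = "(+) \<one>\<^sub>J ` ball 0 (1/4)"
  have "connected ?C" by (intro connected_continuous_image continuous_intros convex_connected convex_ball)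
  moreover have "?C \<subseteq> jinvertibles"
    by (auto simp: jinvertibles_def simp del: image_add_ball intro!: jinvertible_junit_plus)
  moreover have "\<one>\<^sub>J \<in> ?C" by (rule image_eqI[of _ _ 0]) simp_all
  ultimately have "?C \<subseteq> S" using junit_mem by (rule connected_subset)
  thus ?thesis using assms by (auto simp del: image_add_ball)
qed

lemma diff_radical_mem:
  assumes "a \<in> S" and w: "w \<in> mccrimmon_radical"
  shows "a - w \<in> S"
proof -
  let ?C = "(\<lambda>t::real. a - t *\<^sub>R w) ` UNIV"
  have "csubspace (mccrimmon_radical :: 'a set)"
    using quasi_invertible_ideal_mccrimmon_radical by (auto simp: quasi_invertible_ideal_def jideal_def)
  hence "?C \<subseteq> jinvertibles"
    using jinvertible_diff_quasi_invertible_ideal[OF quasi_invertible_ideal_mccrimmon_radical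
        jinvertible[OF assms(1)] csubspace_scaleR[OF _ w]]
    by (auto simp: jinvertibles_def)
  moreover have "connected ?C" by (intro connected_continuous_image continuous_intros connected_UNIV)
  moreover have "a \<in> ?C" by (rule image_eqI[of _ _ 0]) simp_all
  ultimately have "?C \<subseteq> S" using assms(1) by (intro connected_subset)
  moreover have "a - 1 *\<^sub>R w \<in> ?C" by blast
  ultimately show ?thesis by auto
qed

text \<open>The set \<open>P\<close> of all such directions is shown to be a quasi-invertible ideal;
  translating the unit by -v gives quasi-invertibility.\<close>

lemma mem_radical_if_translation_invariant:
  assumes u: "\<And>a c. a \<in> S \<Longrightarrow> a + c *\<^sub>C u \<in> S"
  shows "u \<in> mccrimmon_radical"
proof -
  define P where "P = {v. \<forall>a\<in>S. \<forall>c. a + c *\<^sub>C v \<in> S}"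
  have P: "csubspace P"
    unfolding csubspace_def P_def
    by (auto simp: scaleC_add_right scaleC_scaleC simp flip: add.assoc)
  have U: "U_op b v \<in> P" if b: "b \<in> S" and v: "v \<in> P" for b v
    unfolding P_def
  proof (intro CollectI ballI allI)
    fix a c assume a: "a \<in> S"
    \<comment> \<open>Pull \<open>a\<close> back by U of the inverse of \<open>b\<close>, translate
      there, and return with U_b.\<close>
    have "U_op (jinv b) a + c *\<^sub>C v \<in> S" using v U_op_mem[OF jinv_mem[OF b] a] by (auto simp: P_def)
    from U_op_mem[OF b this] show "a + c *\<^sub>C U_op b v \<in> S"
      by (simp add: U_op_linear_simps U_op_scaleC U_op_jinv[OF jinvertible[OF b]])
  qed
  have "x \<circ>\<^sub>J v \<in> P" if v: "v \<in> P" for x v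
  proof -
    define t where "t = 1 / (4 * (2 + norm x))"
    have t: "t > 0" "norm (t *\<^sub>R x) < 1/4"
      by (auto simp: t_def field_simps add_pos_nonneg)
    \<comment> \<open>The quadratic parts cancel in this difference, leaving a multiple of
      \<open>x \<circ>\<^sub>J v\<close>; \<open>t\<close> is chosen so that both outer elements lie
      in \<open>S\<close>.\<close>
    let ?y = "U_op (\<one>\<^sub>J + t *\<^sub>R x) v - U_op (\<one>\<^sub>J + - (t *\<^sub>R x)) v"
    have "?y = (4 * t) *\<^sub>R (x \<circ>\<^sub>J v)"
      unfolding U_op_junit_plus by (simp add: U_op_eq jprod_linear_simps flip: scaleR_left.add)
    moreover have "?y \<in> P" using t v by (intro csubspace_diff[OF P] U junit_plus_mem) auto
    ultimately have "(1 / (4 * t)) *\<^sub>R ((4 * t) *\<^sub>R (x \<circ>\<^sub>J v)) \<in> P"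
      by (metis csubspace_scaleR[OF P])
    thus ?thesis using t by simp
  qed
  hence "jideal P" by (rule jidealI[OF P])
  moreover have "quasi_invertible v" if "v \<in> P" for v
  proof -
    have "\<one>\<^sub>J + (-1) *\<^sub>C v \<in> S" using that junit_mem by (auto simp: P_def)
    moreover have "(-1) *\<^sub>C v = - v" using scaleR_scaleC[of "-1" v] by simp
    ultimately show ?thesis by (simp add: quasi_invertible_def jinvertible)
  qed
  ultimately have "quasi_invertible_ideal P" by (simp add: quasi_invertible_ideal_def)
  hence "P \<subseteq> mccrimmon_radical" by (rule quasi_invertible_ideal_subset_mccrimmon_radical)
  moreover have "u \<in> P" using u by (simp add: P_def)
  ultimately show ?thesis by blast
qed

end

section \<open>Isometries between clopen quadratic sets\<close>

theorem theorem3p5: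
  fixes \<MM> :: "'a::unital_complex_jordan_banach set"
    and \<NN> :: "'b::unital_complex_jordan_banach set"
    and \<Delta> :: "'a \<Rightarrow> 'b"
  assumes "\<MM> \<subseteq> jinvertibles" and "\<NN> \<subseteq> jinvertibles"
    and "\<MM> \<noteq> {}" and "\<NN> \<noteq> {}"
    and "clopen_in_jinvertibles \<MM>" and "clopen_in_jinvertibles \<NN>"
    and "quadratic_set \<MM>" and "quadratic_set \<NN>"
    and "closed_powers_inverses \<MM>" and "closed_powers_inverses \<NN>"
    and "surjective_isometry \<Delta> \<MM> \<NN>"
  shows "(\<forall>w\<^sub>0\<in>mccrimmon_radical. surjective_isometry (\<lambda>a. \<Delta> a - w\<^sub>0) \<MM> \<NN>) \<and>
    (\<exists>T\<^sub>0 :: 'a \<Rightarrow> 'b. \<exists>u\<^sub>0 \<in> mccrimmon_radical.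
       linear T\<^sub>0 \<and> surjective_isometry T\<^sub>0 UNIV UNIV \<and>
       (\<forall>a\<in>\<MM>. \<Delta> a = T\<^sub>0 a + u\<^sub>0))"
proof -
  interpret M: clopen_quadratic_set \<MM> by unfold_locales fact+
  interpret N: clopen_quadratic_set \<NN> by unfold_locales fact+
  have im: "\<Delta> ` \<MM> = \<NN>" and iso: "\<And>a b. a \<in> \<MM> \<Longrightarrow> b \<in> \<MM> \<Longrightarrow> norm (\<Delta> a - \<Delta> b) = norm (a - b)"
    using \<open>surjective_isometry \<Delta> \<MM> \<NN>\<close> by (auto simp: surjective_isometry_def)
  have translate: "surjective_isometry (\<lambda>a. \<Delta> a - w) \<MM> \<NN>" if w: "w \<in> mccrimmon_radical" for w
  proof -
    have "csubspace (mccrimmon_radical :: 'b set)"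
      using quasi_invertible_ideal_mccrimmon_radical by (auto simp: quasi_invertible_ideal_def jideal_def)
    from csubspace_scaleR[OF this w, of "-1"] have "- w \<in> mccrimmon_radical" by simp
    \<comment> \<open>Translation by the opposite radical element supplies the preimages.\<close>
    hence "b - (- w) \<in> \<NN>" if "b \<in> \<NN>" for b using that by (intro N.diff_radical_mem)
    hence "b \<in> (\<lambda>b. b - w) ` \<NN>" if "b \<in> \<NN>" for b
      using that by (intro image_eqI[of _ _ "b - (- w)"]) auto
    hence "(\<lambda>b. b - w) ` \<Delta> ` \<MM> = \<NN>"
      unfolding im using N.diff_radical_mem[OF _ w] by blast
    thus ?thesis using iso by (simp add: surjective_isometry_def image_image)
  qed
  \<comment> \<open>Beyond the ball around the unit, \<open>W\<close> contains a + (1/c) 1 for every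
    \<open>a\<close> and all small nonzero c.\<close>
  define W :: "'a set" where "W = (\<lambda>(c, x). c *\<^sub>C (\<one>\<^sub>J + x)) ` ((- {0}) \<times> ball 0 (1/4))"
  have "connected (- {0::complex})" by (rule connected_punctured_universe) simp
  hence "connected ((- {0::complex}) \<times> ball (0::'a) (1/4))"
    by (rule connected_Times[OF _ convex_connected[OF convex_ball]])
  hence "connected W"
    unfolding W_def case_prod_beta
    by (intro connected_continuous_image continuous_on_scaleC continuous_intros)
  moreover have "W \<subseteq> \<MM>" by (auto simp: W_def intro!: M.scaleC_mem M.junit_plus_mem)
  moreover have "W \<noteq> {}" by (auto simp: W_def intro: exI[of _ "1::complex"])
  ultimately obtain T u where T: "linear T" "\<And>x. norm (T x) = norm x" "surj T"
    and TW: "\<And>x. x \<in> W \<Longrightarrow> \<Delta> x = T x + u"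
    using surjective_isometry_affine_on_connected[OF \<open>surjective_isometry \<Delta> \<MM> \<NN>\<close> M.open_S N.open_S]
    by metis
  have T_iso: "norm (T a - T b) = norm (a - b)" for a b
    by (metis T(1,2) linear_diff)
  have \<Delta>: "\<Delta> a = T a + u" if a: "a \<in> \<MM>" for a
  proof -
    obtain y where y: "\<Delta> a - u = T y" using T(3) by (metis surjD)
    define \<delta> where "\<delta> = 1 / (4 * (2 + norm a))"
    have \<delta>: "\<delta> > 0" "\<delta> * norm a < 1/4" by (auto simp: \<delta>_def field_simps add_pos_nonneg)
    have "a - y = 0"
    proof (rule junit_complex_extreme[OF \<delta>(1)])
      fix c assume c: "cmod c = \<delta>"
      hence c0: "c \<noteq> 0" using \<delta> by auto
      \<comment> \<open>This is a + (1/c) 1, so \<open>w - a\<close> is a multiple of the unit;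
        equality of its norm with that of \<open>w - y\<close> then gives the bound required at
        \<open>a - y\<close>.\<close>
      define w where "w = (1/c) *\<^sub>C (\<one>\<^sub>J + c *\<^sub>C a)"
      have w_diff: "w - x = (1/c) *\<^sub>C (\<one>\<^sub>J + c *\<^sub>C (a - x))" for x
        using c0 by (simp add: w_def scaleC_add_right scaleC_diff_right scaleC_scaleC scaleC_one)
      have "w \<in> W" unfolding W_def w_def
        by (rule image_eqI[of _ _ "(1/c, c *\<^sub>C a)"]) (use c0 c \<delta> in \<open>auto simp: norm_scaleC\<close>)
      hence "norm (w - y) = norm (\<Delta> w - \<Delta> a)"
        using y by (simp add: TW algebra_simps flip: T_iso)
      also have "\<dots> = norm (w - a)" using iso a \<open>w \<in> W\<close> \<open>W \<subseteq> \<MM>\<close> by blast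
      finally show "norm (\<one>\<^sub>J + c *\<^sub>C (a - y)) \<le> 1"
        using c0 by (simp add: w_diff norm_scaleC norm_junit)
    qed
    thus ?thesis using y by (simp add: algebra_simps)
  qed
  have real: "n + s *\<^sub>R u \<in> \<NN>" if n: "n \<in> \<NN>" for n s
  proof -
    \<comment> \<open>With n = T a + u, shrink \<open>a\<close> by s + 1 before applying \<Delta>
      and multiply by s + 1 afterwards: the result T a + (s + 1) u is n + s u.\<close>
    have *: "n + s *\<^sub>R u \<in> \<NN>" if n: "n \<in> \<NN>" and s: "s \<noteq> -1" for n s
    proof -
      obtain a where a: "a \<in> \<MM>" "n = \<Delta> a" using n im by auto
      have s1: "s + 1 \<noteq> 0" using s by linarith
      have ra: "(1 / (s + 1)) *\<^sub>R a \<in> \<MM>" using a s1 by (intro M.scaleR_mem) auto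
      hence "\<Delta> ((1 / (s + 1)) *\<^sub>R a) \<in> \<NN>" using im by blast
      hence "(1 / (s + 1)) *\<^sub>R T a + u \<in> \<NN>"
        using \<Delta>[OF ra] by (simp add: linear_scale[OF T(1)])
      hence "(s + 1) *\<^sub>R ((1 / (s + 1)) *\<^sub>R T a + u) \<in> \<NN>"
        using s1 by (intro N.scaleR_mem)
      moreover have "(s + 1) *\<^sub>R ((1 / (s + 1)) *\<^sub>R T a + u) = n + s *\<^sub>R u"
        using s1 a by (simp add: \<Delta> scaleR_add_right scaleR_left.add)
      ultimately show ?thesis by simp
    qed
    show ?thesis
    proof (cases "s = -1")
      case True
      \<comment> \<open>The excluded value -1 is reached in two half steps.\<close>
      have "(n + (-1/2) *\<^sub>R u) + (-1/2) *\<^sub>R u \<in> \<NN>" by (intro * n) auto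
      also have "(n + (-1/2) *\<^sub>R u) + (-1/2) *\<^sub>R u = n + s *\<^sub>R u"
        unfolding True dist_le_zero_iff[symmetric] by norm
      finally show ?thesis .
    qed (use * n in blast)
  qed
  have "u \<in> mccrimmon_radical"
  proof (rule N.mem_radical_if_translation_invariant)
    fix n c assume n: "n \<in> \<NN>"
    show "n + c *\<^sub>C u \<in> \<NN>"
    proof (cases "c = 0")
      case False
      \<comment> \<open>Rotating by the phase of c reduces to a real multiple of
        \<open>u\<close>.\<close>
      define e where "e = c / of_real (cmod c)"
      have e: "e \<noteq> 0" "e * of_real (cmod c) = c" using False by (auto simp: e_def)
      have "e *\<^sub>C ((1/e) *\<^sub>C n + cmod c *\<^sub>R u) \<in> \<NN>"
        using e(1) n by (intro N.scaleC_mem real) auto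
      moreover have "e *\<^sub>C ((1/e) *\<^sub>C n + cmod c *\<^sub>R u) = n + c *\<^sub>C u"
        using e by (simp add: scaleC_add_right scaleC_scaleC scaleC_one scaleR_scaleC)
      ultimately show ?thesis by simp
    qed (use n in simp)
  qed
  moreover have "surjective_isometry T UNIV UNIV"
    using T(3) T_iso by (simp add: surjective_isometry_def)
  ultimately show ?thesis using translate T(1) \<Delta> by blast
qed

end
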